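(* Let $(x_i,y_j)\notin\partial\Omega$ be an interior regular grid point, so that $a$ is positive and smooth near $(x_i,y_j)$, and take $(x_i^*,y_j^* )=(x_i,y_j)$ as base point. Let $$C_{k,\ell}(h)=\sum_{i=0}^{7}c_{k,\ell,i}h^i,\qquad k,\ell\in\{-1,0,1\},$$ be any non-trivial solution of the linear system (in the unknowns $c_{k,\ell,i}\in\mathbb{R}$) induced by $$\sum_{k=-1}^1\sum_{\ell=-1}^1 C_{k,\ell}(h)\,G^V_{6,m,n}(kh,\ell h)=\mathcal{O}(h^{8}),\quad h\to0,\qquad\text{for all }(m,n)\in\Lambda_7^{V,1},$$ and put $C_{f,m,n}:=\sum_{k=-1}^1\sum_{\ell=-1}^1C_{k,\ell}(h)\,Q^V_{6,m,n}(kh,\ell h)$ for $(m,n)\in\Lambda_5$. Then the compact 9-point scheme $$\sum_{k=-1}^1\sum_{\ell=-1}^1 C_{k,\ell}(h)\,(u_h)_{i+k,j+\ell}=\sum_{(m,n)\in\Lambda_5}f^{(m,n)}C_{f,m,n}$$ achieves sixth order of accuracy for $-\nabla\cdot(a\nabla u)=f$ at $(x_i,y_j)$. Moreover, the maximum accuracy order of a compact 9-point finite difference scheme for $-\nabla\cdot(a\nabla u)=f$ at $(x_i,y_j)$ is six.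
   Context: **Grid and problem.** $\Omega=(l_1,l_2)\times(l_3,l_4)$ is a rectangle with a uniform Cartesian grid $x_i=l_1+ih$, $y_j=l_3+jh$ of mesh size $h$. A smooth curve $\Gamma_I=\{\psi=0\}$ splits $\Omega$ into $\Omega^+=\{\psi>0\}$ and $\Omega^-=\{\psi<0\}$. The equation $-\nabla\cdot(a\nabla u)=f$ holds in $\Omega\setminus\Gamma_I$, with $a$ positive and smooth in each of $\Omega^\pm$. A grid point is regular if the nine points $(x_i+kh,y_j+\ell h)$, $k,\ell\in\{-1,0,1\}$, all lie in $\Omega^+\cup\Gamma_I$ or all lie in $\Omega^-$. All considerations are local at the fixed point $(x_i,y_j)$, in one subregion (with $a,u,f$ smooth up to its boundary and extended smoothly if needed), as $h\to0^+$. $(u_h)_{i,j}$ denotes the numerical approximation of $u(x_i,y_j)$. **Notation.** $a^{(m,n)},u^{(m,n)},f^{(m,n)}$ denote $\partial_x^m\partial_y^n$ of $a,u,f$ at the base point $(x_i^*,y_j^* )$. For an integer $N\ge0$: $\Lambda_N=\{(m,n)\in\mathbb{N}_0^2: m+n\le N\}$, $\Lambda_N^{V,1}=\{(m,n)\in\Lambda_N: m\in\{0,1\}\}$, $\Lambda_N^{V,2}=\Lambda_N\setminus\Lambda_N^{V,1}$. **The functions $G^V_{M,m,n}$ and $Q^V_{M,m,n}$.** For smooth $u$ and $f=-\nabla\cdot(a\nabla u)$, solving the equation for $u_{xx}$ and differentiating repeatedly, each $u^{(m',n')}$ with $(m',n')\in\Lambda_{M+1}^{V,2}$ is written uniquely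 (identically in $u$) as $$u^{(m',n')}=\sum_{(m,n)\in\Lambda_{M+1}^{V,1},\,m+n\le m'+n'}A^{V,u}_{m',n',m,n}u^{(m,n)}+\sum_{(m,n)\in\Lambda_{M-1},\,m+n\le m'+n'-2}A^{V,f}_{m',n',m,n}f^{(m,n)},$$ with constants determined by $\{a^{(m,n)}:(m,n)\in\Lambda_M\}$. Then for $(m,n)\in\Lambda_{M+1}^{V,1}$, $$G^V_{M,m,n}(x,y)=\sum_{\ell=0}^{\lfloor n/2\rfloor}\frac{(-1)^\ell x^{m+2\ell}y^{n-2\ell}}{(m+2\ell)!(n-2\ell)!}+\sum_{(m',n')\in\Lambda_{M+1}^{V,2},\,m'+n'>m+n}A^{V,u}_{m',n',m,n}\frac{x^{m'}y^{n'}}{m'!n'!},$$ and for $(m,n)\in\Lambda_{M-1}$, $$Q^V_{M,m,n}(x,y)=\frac1{a^{(0,0)}}\sum_{\ell=1}^{1+\lfloor n/2\rfloor}\frac{(-1)^\ell x^{m+2\ell}y^{n-2\ell+2}}{(m+2\ell)!(n-2\ell+2)!}+\sum_{(m',n')\in\Lambda_{M+1}^{V,2},\,m'+n'>m+n+2}A^{V,f}_{m',n',m,n}\frac{x^{m'}y^{n'}}{m'!n'!}.$$ **Non-trivial and accuracy order.** A family $\{C_{k,\ell}(h)\}$ is non-trivial if $C_{k,\ell}(0)\neq0$ for at least one $(k,\ell)$. A compact 9-point scheme at an interior regular point is given by non-trivial polynomials $C_{k,\ell}(h)$ and a right-hand side that is a finite linear combination of the $f^{(m,n)}$ with coefficients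 $D_{m,n}(h)$ depending only on $a$ and $h$. It has accuracy order $p$ if, for every smooth $u$ near the point with $f=-\nabla\cdot(a\nabla u)$, $$\sum_{k,\ell}C_{k,\ell}(h)u(x_i+kh,y_j+\ell h)-\sum_{m,n}f^{(m,n)}D_{m,n}(h)=\mathcal{O}(h^{p+2}),\quad h\to0$$ (i.e. $\mathcal{O}(h^p)$ after division by $h^2$). The maximum accuracy order is the largest $p$ for which such a scheme exists for the given $a$. *)

theory Defs
  imports
    "HOL-Analysis.Analysis"
    "HOL-Computational_Algebra.Polynomial"
    "HOL-Library.Landau_Symbols"
begin

definition pdx :: "(real \<Rightarrow> real \<Rightarrow> real) \<Rightarrow> real \<Rightarrow> real \<Rightarrow> real" where
  "pdx F = (\<lambda>x y. deriv (\<lambda>s. F s y) x)"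

definition pdy :: "(real \<Rightarrow> real \<Rightarrow> real) \<Rightarrow> real \<Rightarrow> real \<Rightarrow> real" where
  "pdy F = (\<lambda>x y. deriv (\<lambda>t. F x t) y)"

definition pd :: "nat \<Rightarrow> nat \<Rightarrow> (real \<Rightarrow> real \<Rightarrow> real) \<Rightarrow> real \<Rightarrow> real \<Rightarrow> real" where
  "pd m n F = (pdx ^^ m) ((pdy ^^ n) F)"

text \<open>\<open>C_k_on k U F\<close>: all mixed partial derivatives of \<open>F\<close> of order at most \<open>k\<close>, in any
  order of differentiation, exist and are continuous on the (open) set \<open>U\<close>.\<close>

primrec C_k_on :: "nat \<Rightarrow> (real \<times> real) set \<Rightarrow> (real \<Rightarrow> real \<Rightarrow> real) \<Rightarrow> bool" where
  "C_k_on 0 U F \<longleftrightarrow> continuous_on U (\<lambda>(x, y). F x y)"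
| "C_k_on (Suc k) U F \<longleftrightarrow>
     continuous_on U (\<lambda>(x, y). F x y) \<and>
     (\<forall>(x, y)\<in>U. (\<lambda>s. F s y) differentiable (at x) \<and> (\<lambda>t. F x t) differentiable (at y)) \<and>
     C_k_on k U (pdx F) \<and> C_k_on k U (pdy F)"

definition smooth_on :: "(real \<times> real) set \<Rightarrow> (real \<Rightarrow> real \<Rightarrow> real) \<Rightarrow> bool" where
  "smooth_on U F \<longleftrightarrow> (\<forall>k. C_k_on k U F)"

definition smooth_near :: "(real \<Rightarrow> real \<Rightarrow> real) \<Rightarrow> real \<Rightarrow> real \<Rightarrow> bool" where
  "smooth_near F x y \<longleftrightarrow> (\<exists>U. open U \<and> (x, y) \<in> U \<and> smooth_on U F)"

text \<open>The source term \<open>f = - div (a grad u)\<close>.\<close>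

definition elliptic :: "(real \<Rightarrow> real \<Rightarrow> real) \<Rightarrow> (real \<Rightarrow> real \<Rightarrow> real) \<Rightarrow> real \<Rightarrow> real \<Rightarrow> real" where
  "elliptic a u = (\<lambda>x y. - (pdx (\<lambda>x y. a x y * pdx u x y) x y + pdy (\<lambda>x y. a x y * pdy u x y) x y))"

definition Lam :: "nat \<Rightarrow> (nat \<times> nat) set" where
  "Lam N = {(m, n). m + n \<le> N}"

definition LamV1 :: "nat \<Rightarrow> (nat \<times> nat) set" where
  "LamV1 N = {(m, n) \<in> Lam N. m \<in> {0, 1}}"

definition LamV2 :: "nat \<Rightarrow> (nat \<times> nat) set" where
  "LamV2 N = Lam N - LamV1 N"

definition idx_u :: "nat \<Rightarrow> nat \<Rightarrow> nat \<Rightarrow> (nat \<times> nat) set" where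
  "idx_u M m' n' = {(m, n) \<in> LamV1 (M + 1). m + n \<le> m' + n'}"

text \<open>The bound \<open>m + n \<le> m' + n' - 2\<close> is written without truncated subtraction.\<close>

definition idx_f :: "nat \<Rightarrow> nat \<Rightarrow> nat \<Rightarrow> (nat \<times> nat) set" where
  "idx_f M m' n' = {(m, n) \<in> Lam (M - 1). m + n + 2 \<le> m' + n'}"

text \<open>The coefficients in the expansion of \<open>pd m' n' u\<close> at \<open>(x0, y0)\<close>, identically in
  \<open>u\<close>; they are normalised to be zero outside the two index sets, so that the pair
  \<open>(A, B)\<close> of coefficient functions is unique.\<close>

definition V_expansion ::
  "(real \<Rightarrow> real \<Rightarrow> real) \<Rightarrow> real \<Rightarrow> real \<Rightarrow> nat \<Rightarrow> nat \<Rightarrow> nat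
    \<Rightarrow> (nat \<times> nat \<Rightarrow> real) \<Rightarrow> (nat \<times> nat \<Rightarrow> real) \<Rightarrow> bool" where
  "V_expansion a x0 y0 M m' n' A B \<longleftrightarrow>
     (\<forall>p. p \<notin> idx_u M m' n' \<longrightarrow> A p = 0) \<and>
     (\<forall>p. p \<notin> idx_f M m' n' \<longrightarrow> B p = 0) \<and>
     (\<forall>u. smooth_near u x0 y0 \<longrightarrow>
        pd m' n' u x0 y0 =
          (\<Sum>(m, n)\<in>idx_u M m' n'. A (m, n) * pd m n u x0 y0) +
          (\<Sum>(m, n)\<in>idx_f M m' n'. B (m, n) * pd m n (elliptic a u) x0 y0))"

definition AVu ::
  "(real \<Rightarrow> real \<Rightarrow> real) \<Rightarrow> real \<Rightarrow> real \<Rightarrow> nat \<Rightarrow> nat \<Rightarrow> nat \<Rightarrow> nat \<Rightarrow> nat \<Rightarrow> real" where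
  "AVu a x0 y0 M m' n' m n = fst (THE (A, B). V_expansion a x0 y0 M m' n' A B) (m, n)"

definition AVf ::
  "(real \<Rightarrow> real \<Rightarrow> real) \<Rightarrow> real \<Rightarrow> real \<Rightarrow> nat \<Rightarrow> nat \<Rightarrow> nat \<Rightarrow> nat \<Rightarrow> nat \<Rightarrow> real" where
  "AVf a x0 y0 M m' n' m n = snd (THE (A, B). V_expansion a x0 y0 M m' n' A B) (m, n)"

definition GV ::
  "(real \<Rightarrow> real \<Rightarrow> real) \<Rightarrow> real \<Rightarrow> real \<Rightarrow> nat \<Rightarrow> nat \<Rightarrow> nat \<Rightarrow> real \<Rightarrow> real \<Rightarrow> real" where
  "GV a x0 y0 M m n x y =
     (\<Sum>l = 0..n div 2. (-1) ^ l * x ^ (m + 2 * l) * y ^ (n - 2 * l)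
                          / (fact (m + 2 * l) * fact (n - 2 * l))) +
     (\<Sum>(m', n') \<in> {(m', n') \<in> LamV2 (M + 1). m' + n' > m + n}.
        AVu a x0 y0 M m' n' m n * (x ^ m' * y ^ n' / (fact m' * fact n')))"

text \<open>The exponent \<open>n - 2l + 2\<close> is written as \<open>n + 2 - 2l\<close>, because for
  \<open>l = 1 + n div 2\<close> the subtraction \<open>n - 2l\<close> would truncate.\<close>

definition QV ::
  "(real \<Rightarrow> real \<Rightarrow> real) \<Rightarrow> real \<Rightarrow> real \<Rightarrow> nat \<Rightarrow> nat \<Rightarrow> nat \<Rightarrow> real \<Rightarrow> real \<Rightarrow> real" where
  "QV a x0 y0 M m n x y =
     1 / a x0 y0 *
     (\<Sum>l = 1..1 + n div 2. (-1) ^ l * x ^ (m + 2 * l) * y ^ (n + 2 - 2 * l)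
                              / (fact (m + 2 * l) * fact (n + 2 - 2 * l))) +
     (\<Sum>(m', n') \<in> {(m', n') \<in> LamV2 (M + 1). m' + n' > m + n + 2}.
        AVf a x0 y0 M m' n' m n * (x ^ m' * y ^ n' / (fact m' * fact n')))"

text \<open>A compact 9-point scheme consists of stencil coefficients \<open>C k l\<close> (polynomials in \<open>h\<close>,
  relevant only for \<open>k, l \<in> {-1, 0, 1}\<close>), a finite index set \<open>S\<close> and functions
  \<open>D m n\<close> of \<open>h\<close>, the right-hand side being the combination of the derivatives \<open>pd m n f\<close>,
  \<open>(m, n) \<in> S\<close>, with coefficients \<open>D m n h\<close>.\<close>

definition nontrivial :: "(int \<Rightarrow> int \<Rightarrow> real poly) \<Rightarrow> bool" where
  "nontrivial C \<longleftrightarrow> (\<exists>k\<in>{-1..1}. \<exists>l\<in>{-1..1}. poly (C k l) 0 \<noteq> 0)"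

definition scheme_has_order ::
  "(real \<Rightarrow> real \<Rightarrow> real) \<Rightarrow> real \<Rightarrow> real \<Rightarrow> (int \<Rightarrow> int \<Rightarrow> real poly)
    \<Rightarrow> (nat \<times> nat) set \<Rightarrow> (nat \<Rightarrow> nat \<Rightarrow> real \<Rightarrow> real) \<Rightarrow> nat \<Rightarrow> bool" where
  "scheme_has_order a x0 y0 C S D p \<longleftrightarrow>
     nontrivial C \<and> finite S \<and>
     (\<forall>u. smooth_near u x0 y0 \<longrightarrow>
        (\<lambda>h. (\<Sum>k\<in>{-1..1}. \<Sum>l\<in>{-1..1}.
                poly (C k l) h * u (x0 + of_int k * h) (y0 + of_int l * h))
             - (\<Sum>(m, n)\<in>S. pd m n (elliptic a u) x0 y0 * D m n h))
        \<in> O[at_right 0](\<lambda>h. h ^ (p + 2)))"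

definition is_max_accuracy_order ::
  "(real \<Rightarrow> real \<Rightarrow> real) \<Rightarrow> real \<Rightarrow> real \<Rightarrow> nat \<Rightarrow> bool" where
  "is_max_accuracy_order a x0 y0 p \<longleftrightarrow>
     (\<exists>C S D. scheme_has_order a x0 y0 C S D p) \<and>
     (\<forall>q. (\<exists>C S D. scheme_has_order a x0 y0 C S D q) \<longrightarrow> q \<le> p)"

end

theory Submission
  imports Defs "HOL-Computational_Algebra.Formal_Power_Series"
begin

text \<open>
  The expansion of the scheme in powers of \<open>h\<close> depends on \<open>u\<close> only
  through its Taylor coefficients at \<open>(x0, y0)\<close>. So every smooth function is
  replaced by its jet, the formal power series in \<open>x\<close> and \<open>y\<close> with
  coefficients \<open>pd m n u x0 y0 / (m! n!)\<close>. Taking jets respects sums, products and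
  partial derivatives (\<open>jet_add\<close>, \<open>jet_mult\<close>, \<open>jet_pdx\<close>,
  \<open>jet_pdy\<close>), so that the jet of \<open>f = - div (a grad u)\<close> is \<open>Ell
  A U\<close>, where \<open>A\<close> and \<open>U\<close> are the jets of \<open>a\<close> and
  \<open>u\<close>. The substitution \<open>x = k h\<close>, \<open>y = l h\<close>
  (\<open>along k l\<close>) is a ring homomorphism into the power series in \<open>h\<close>,
  and by Taylor's theorem (\<open>taylor_along\<close>) it describes \<open>u\<close> at a
  stencil point. All the rest is algebra with power series, except that polynomials are needed
  to realise prescribed jets.

  The meaning of \<open>GV\<close> and \<open>QV\<close>. As \<open>a x0 y0 \<noteq> 0\<close>,
  the equation \<open>Ell A U = F\<close> can be solved formally for any \<open>F\<close> and
  any Cauchy data on the line \<open>x = 0\<close>, that is, any coefficients of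
  \<open>x^0\<close> and \<open>x^1\<close>; these are the derivatives indexed by
  \<open>LamV1\<close>. Let \<open>Gsol m n\<close> and \<open>Qsol m n\<close> be the solutions
  for which exactly one datum is nonzero (a Cauchy datum, or a derivative of \<open>F\<close>).
  Every jet is a combination of them up to any given order (\<open>jet_expansion\<close>).
  Therefore the coefficients in the expansion of \<open>pd m' n' u\<close> are the derivatives
  of these solutions, and \<open>GV\<close> and \<open>QV\<close> are their Taylor polynomials
  (\<open>GV_eq\<close>, \<open>QV_eq\<close>). This gives \<open>u = (\<Sum> pd m n u * GV) +
  (\<Sum> pd m n f * QV) + O(h^8)\<close> at the stencil points, and hence the accuracy of each
  stencil that annihilates the functions \<open>GV\<close> up to \<open>O(h^8)\<close>
  (\<open>scheme_accuracy\<close>).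

  Order six is attained for every \<open>a\<close>. Write \<open>A = s * s\<close>. If
  \<open>Ell A U = 0\<close>, then \<open>v = s * U\<close> satisfies \<open>Lap v = q *
  v\<close> with \<open>q = Lap s / s\<close>: the first-order terms are gone. The nine-point
  Laplacian \<open>S\<close> has the expansion \<open>S v = 6 h^2 (Lap v + h^2/12 Lap^2 v +
  h^4/360 (Lap^3 v + 2 \<partial>x^2 \<partial>y^2 Lap v)) + O(h^8)\<close> at the centre. Here
  each \<open>Lap v\<close> is replaced by \<open>W = q * v\<close>. The values of
  \<open>W\<close> at the nine points are known multiples of those of \<open>v\<close>; so the
  stencil itself, applied to \<open>W\<close>, yields \<open>Lap W\<close>, and second
  differences yield \<open>\<partial>x^2 \<partial>y^2 W\<close>. What is left is a multiple of
  \<open>h^6 Lap^2 W\<close>. Eliminating \<open>Lap v\<close> once more turns it into a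
  combination of derivatives of \<open>v\<close> of order at most two
  (\<open>Lap_Lap_potential\<close>), for which central differences suffice. At \<open>h =
  0\<close> the weights are those of \<open>S\<close> up to a nonzero factor, hence the scheme
  is non-trivial (\<open>compact_stencil_exists\<close>).

  Order seven is impossible. A scheme of order \<open>q\<close> applied to a polynomial whose
  jet agrees with \<open>Gsol m n\<close> up to high order has vanishing right-hand side. Since
  \<open>Gsol m n\<close> begins with a homogeneous harmonic polynomial of degree \<open>m +
  n\<close>, the weights \<open>C k l 0\<close> must annihilate all harmonic polynomials of
  degree at most \<open>q + 1\<close>. Through degree 7, the nine-point Laplacian does so. In
  degree 8 the real part of \<open>(x + i y)^8\<close> is 1 at the edge midpoints and 16 at the
  corners, whereas in degree 4 the values are 1 and -4; together with the constant these
  separate centre, edges and corners. So all nine weights vanish at \<open>h = 0\<close>, and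
  the scheme is trivial (\<open>order_at_most_six\<close>).
\<close>

section \<open>The algebra of jets\<close>

text \<open>
  A jet is a power series in \<open>x\<close> whose coefficients are power series in
  \<open>y\<close>. This encoding gets the ring structure from the type of power series;
  \<open>jc U m n\<close> is the coefficient of \<open>x^m y^n\<close>.
\<close>
abbreviation jc :: "real fps fps \<Rightarrow> nat \<Rightarrow> nat \<Rightarrow> real" where
  "jc U m n \<equiv> fps_nth (fps_nth U m) n"

lemma jet_eqI: "(\<And>m n. jc U m n = jc V m n) \<Longrightarrow> U = V"
  by (intro fps_ext) auto

definition Dx :: "real fps fps \<Rightarrow> real fps fps" where
  "Dx U = fps_deriv U"

definition Dy :: "real fps fps \<Rightarrow> real fps fps" where
  "Dy U = Abs_fps (\<lambda>m. fps_deriv (fps_nth U m))"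

definition cst :: "real \<Rightarrow> real fps fps" where
  "cst c = fps_const (fps_const c)"

lemma jc_Dx [simp]: "jc (Dx U) m n = real (Suc m) * jc U (Suc m) n"
  by (simp add: Dx_def flip: of_nat_Suc)

lemma jc_Dy [simp]: "jc (Dy U) m n = real (Suc n) * jc U m (Suc n)"
  by (simp add: Dy_def)

lemma jc_cst [simp]: "jc (cst c) m n = (if m = 0 \<and> n = 0 then c else 0)"
  by (simp add: cst_def)

lemma jc_cst_mult [simp]: "jc (cst c * U) m n = c * jc U m n"
  by (simp add: cst_def)

lemma jc_mult_cst [simp]: "jc (U * cst c) m n = c * jc U m n"
  using jc_cst_mult by (simp add: mult.commute)

lemma jc_mult: "jc (U * V) m n = (\<Sum>i\<le>m. \<Sum>j\<le>n. jc U i j * jc V (m - i) (n - j))"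
  by (simp add: fps_mult_nth fps_sum_nth atMost_atLeast0)

lemma jc_sum: "jc (sum F S) m n = (\<Sum>s\<in>S. jc (F s) m n)"
  by (simp add: fps_sum_nth)

lemma Dx_mult: "Dx (U * V) = Dx U * V + U * Dx V"
  by (simp add: Dx_def)

lemma Dy_mult: "Dy (U * V) = Dy U * V + U * Dy V"
  by (rule fps_ext) (simp add: Dy_def fps_mult_nth fps_deriv_sum sum.distrib add.commute)

lemma Dx_add [simp]: "Dx (U + V) = Dx U + Dx V" and Dy_add [simp]: "Dy (U + V) = Dy U + Dy V"
  and Dx_diff [simp]: "Dx (U - V) = Dx U - Dx V" and Dy_diff [simp]: "Dy (U - V) = Dy U - Dy V"
  and Dx_zero [simp]: "Dx 0 = 0" and Dy_zero [simp]: "Dy 0 = 0"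
  by (intro jet_eqI; simp add: algebra_simps)+

lemma Dx_cst [simp]: "Dx (cst c) = 0" and Dy_cst [simp]: "Dy (cst c) = 0"
  by (intro jet_eqI; simp)+

lemma Dy_Dx: "Dy (Dx U) = Dx (Dy U)"
  by (intro jet_eqI) simp

text \<open>
  A formal series over the reals is determined by its constant term and its derivatives, as the
  characteristic is zero.
\<close>
lemma jet_eqI_deriv:
  assumes "jc U 0 0 = jc V 0 0" "Dx U = Dx V" "Dy U = Dy V"
  shows "U = V"
proof (rule jet_eqI)
  fix m n
  have "jc (Dx U) (m-1) n = jc (Dx V) (m-1) n" "jc (Dy U) m (n-1) = jc (Dy V) m (n-1)"
    using assms by simp_all
  then show "jc U m n = jc V m n"
    using assms(1) by (cases m; cases n) (auto simp del: of_nat_Suc)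
qed

text \<open>
  The substitution \<open>x = k h\<close>, \<open>y = l h\<close>: the result is a power series
  in \<open>h\<close>, and its coefficient of \<open>h^N\<close> collects the terms of total
  degree \<open>N\<close>.
\<close>
definition along :: "real \<Rightarrow> real \<Rightarrow> real fps fps \<Rightarrow> real fps" where
  "along k l U = Abs_fps (\<lambda>N. \<Sum>i\<le>N. jc U i (N - i) * k ^ i * l ^ (N - i))"

definition Dir :: "real \<Rightarrow> real \<Rightarrow> real fps fps \<Rightarrow> real fps fps" where
  "Dir k l U = cst k * Dx U + cst l * Dy U"

lemma along_add: "along k l (U + V) = along k l U + along k l V"
  by (rule fps_ext) (simp add: along_def sum.distrib algebra_simps)

lemma Dir_mult: "Dir k l (U * V) = Dir k l U * V + U * Dir k l V"
  by (simp add: Dir_def Dx_mult Dy_mult algebra_simps)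

text \<open>
  The chain rule for the substitution. Multiplicativity of \<open>along\<close> and Taylor's
  theorem are both derived from it by induction on the degree.
\<close>
lemma fps_deriv_along: "fps_deriv (along k l U) = along k l (Dir k l U)"
proof (rule fps_ext)
  fix N
  let ?t = "\<lambda>i. jc U i (Suc N - i) * k ^ i * l ^ (Suc N - i)"
  have "fps_nth (fps_deriv (along k l U)) N = (\<Sum>i\<le>Suc N. real (Suc N) * ?t i)"
    unfolding sum_distrib_left[symmetric] by (simp add: along_def)
  also have "\<dots> = (\<Sum>i\<le>Suc N. real i * ?t i + real (Suc N - i) * ?t i)"
    by (intro sum.cong refl) (auto simp: of_nat_diff algebra_simps)
  also have "\<dots> = (\<Sum>i\<le>Suc N. real i * ?t i) + (\<Sum>i\<le>Suc N. real (Suc N - i) * ?t i)"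
    by (rule sum.distrib)
  also have "(\<Sum>i\<le>Suc N. real i * ?t i) = (\<Sum>i\<le>N. real (Suc i) * ?t (Suc i))"
    by (simp add: sum.atMost_Suc_shift del: sum.atMost_Suc)
  also have "(\<Sum>i\<le>Suc N. real (Suc N - i) * ?t i) = (\<Sum>i\<le>N. real (Suc N - i) * ?t i)"
    by (simp add: sum.atMost_Suc[of _ N])
  also have "(\<Sum>i\<le>N. real (Suc i) * ?t (Suc i)) + \<dots>
      = (\<Sum>i\<le>N. jc (Dir k l U) i (N - i) * k ^ i * l ^ (N - i))"
    unfolding sum.distrib[symmetric]
    by (intro sum.cong refl) (auto simp: Dir_def Suc_diff_le algebra_simps)
  finally show "fps_nth (fps_deriv (along k l U)) N = fps_nth (along k l (Dir k l U)) N"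
    by (simp add: along_def)
qed

lemma along_0 [simp]: "fps_nth (along k l U) 0 = jc U 0 0"
  by (simp add: along_def)

text \<open>
  Both sides have the same constant term, and their derivatives agree in degree \<open>N\<close>
  by the product rule and the induction hypothesis; this avoids rearranging the double
  convolution.
\<close>
lemma along_mult: "along k l (U * V) = along k l U * along k l V"
proof (rule fps_ext)
  fix N
  show "fps_nth (along k l (U * V)) N = fps_nth (along k l U * along k l V) N"
  proof (induction N arbitrary: U V)
    case (Suc N)
    have "fps_nth (fps_deriv (along k l (U * V))) N
        = fps_nth (fps_deriv (along k l U * along k l V)) N"
      unfolding fps_deriv_along fps_deriv_mult Dir_mult along_add fps_add_nth Suc.IH
      by (simp add: algebra_simps)
    then show ?case
      by (simp only: fps_deriv_nth) (simp del: of_nat_Suc)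
  qed simp
qed

section \<open>Formal solutions of the elliptic equation\<close>

text \<open>The operator \<open>- div (A grad U)\<close> on jets.\<close>
definition Ell :: "real fps fps \<Rightarrow> real fps fps \<Rightarrow> real fps fps" where
  "Ell A U = - (Dx (A * Dx U) + Dy (A * Dy U))"

lemma Ell_add: "Ell A (U + V) = Ell A U + Ell A V"
  and Ell_diff: "Ell A (U - V) = Ell A U - Ell A V"
  and Ell_zero [simp]: "Ell A 0 = 0"
  by (simp_all add: Ell_def algebra_simps)

lemma Ell_cst_mult: "Ell A (cst c * U) = cst c * Ell A U"
  by (simp add: Ell_def Dx_mult Dy_mult algebra_simps)

lemma Ell_sum: "Ell A (\<Sum>s\<in>S. cst (c s) * F s) = (\<Sum>s\<in>S. cst (c s) * Ell A (F s))"
  by (induction S rule: infinite_finite_induct) (simp_all add: Ell_add Ell_cst_mult)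

text \<open>
  The coefficient of \<open>x^m\<close> in \<open>Ell A U = F\<close> contains the coefficient
  of \<open>x^(m + 2)\<close> in \<open>U\<close> only through \<open>(m + 1) (m + 2) A$0 U$(m +
  2)\<close>, where \<open>A$0\<close> is a unit as its constant term is nonzero. Solving for it
  gives the recursion of the Cauchy--Kovalevskaya theorem, started with the coefficients of
  \<open>x^0\<close> and \<open>x^1\<close> in \<open>D\<close>.
\<close>
function ck_coeff :: "real fps fps \<Rightarrow> real fps fps \<Rightarrow> real fps fps \<Rightarrow> nat \<Rightarrow> real fps" where
  "ck_coeff A D F 0 = fps_nth D 0"
| "ck_coeff A D F (Suc 0) = fps_nth D 1"
| "ck_coeff A D F (Suc (Suc m)) =
     fps_const (1 / (real (Suc m) * real (Suc (Suc m)))) * inverse (fps_nth A 0) *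
     (- fps_nth F m
      - fps_deriv (\<Sum>i\<in>{0..m}. fps_nth A i * fps_deriv (ck_coeff A D F (m - i)))
      - of_nat (Suc m) * (\<Sum>i\<in>{Suc 0..Suc m}.
           fps_nth A i * (of_nat (Suc (Suc m - i)) * ck_coeff A D F (Suc (Suc m - i)))))"
  by pat_completeness auto
termination
  by (relation "inv_image less_than (\<lambda>(A, D, F, m). m)") auto

lemma formal_solution_exists:
  assumes "jc A 0 0 \<noteq> 0"
  shows "\<exists>U. fps_nth U 0 = fps_nth D 0 \<and> fps_nth U 1 = fps_nth D 1 \<and> Ell A U = F"
proof (intro exI conjI)
  let ?U = "Abs_fps (ck_coeff A D F)"
  show "fps_nth ?U 0 = fps_nth D 0" "fps_nth ?U 1 = fps_nth D 1" by simp_all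
  show "Ell A ?U = F"
  proof (rule fps_ext)
    fix m
    define S where "S = (\<Sum>i\<in>{Suc 0..Suc m}.
           fps_nth A i * (of_nat (Suc (Suc m - i)) * ck_coeff A D F (Suc (Suc m - i))))"
    define T where "T = fps_deriv (\<Sum>i\<in>{0..m}. fps_nth A i * fps_deriv (ck_coeff A D F (m - i)))"
    have inv: "fps_nth A 0 * inverse (fps_nth A 0) = 1"
      using assms by (metis inverse_mult_eq_1')
    have "fps_nth (A * Dx ?U) (Suc m)
        = fps_nth A 0 * (of_nat (Suc (Suc m)) * ck_coeff A D F (Suc (Suc m))) + S"
      unfolding fps_mult_nth S_def Dx_def fps_deriv_nth
      by (subst sum.atLeast_Suc_atMost) (auto simp del: of_nat_Suc ck_coeff.simps)
    then have "fps_nth (Dx (A * Dx ?U)) m = of_nat (Suc m) *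
        (fps_nth A 0 * (of_nat (Suc (Suc m)) * ck_coeff A D F (Suc (Suc m))) + S)"
      unfolding Dx_def fps_deriv_nth by simp
    also have "\<dots> = fps_const (real (Suc m) * real (Suc (Suc m))) * fps_nth A 0 *
          ck_coeff A D F (Suc (Suc m)) + of_nat (Suc m) * S"
      unfolding fps_of_nat[symmetric] fps_const_mult[symmetric] by (simp only: algebra_simps)
    also have "fps_const (real (Suc m) * real (Suc (Suc m))) * fps_nth A 0 *
          ck_coeff A D F (Suc (Suc m)) =
        (fps_const (real (Suc m) * real (Suc (Suc m)))
          * fps_const (1 / (real (Suc m) * real (Suc (Suc m)))))
        * (fps_nth A 0 * inverse (fps_nth A 0)) * (- fps_nth F m - T - of_nat (Suc m) * S)"
      unfolding ck_coeff.simps(3) S_def[symmetric] T_def[symmetric] by (simp only: ac_simps)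
    also have "\<dots> = - fps_nth F m - T - of_nat (Suc m) * S"
      unfolding inv fps_const_mult by (simp del: of_nat_Suc)
    finally have 1: "fps_nth (Dx (A * Dx ?U)) m = - fps_nth F m - T" by simp
    have 2: "fps_nth (Dy (A * Dy ?U)) m = T"
      by (simp add: T_def Dy_def fps_mult_nth)
    show "fps_nth (Ell A ?U) m = fps_nth F m"
      by (simp add: Ell_def 1 2)
  qed
qed

text \<open>
  The powers of the maximal ideal: series without terms of total degree below \<open>N\<close>.
\<close>
definition order_ge :: "nat \<Rightarrow> real fps fps \<Rightarrow> bool" where
  "order_ge N U \<longleftrightarrow> (\<forall>m n. m + n < N \<longrightarrow> jc U m n = 0)"

lemma order_geD: "order_ge N U \<Longrightarrow> m + n < N \<Longrightarrow> jc U m n = 0"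
  by (simp add: order_ge_def)

lemma order_ge_mult: 
  assumes "order_ge p U" "order_ge q V" shows "order_ge (p + q) (U * V)"
  unfolding order_ge_def
proof (intro allI impI)
  fix m n assume *: "m + n < p + q"
  show "jc (U * V) m n = 0" unfolding jc_mult
  proof (intro sum.neutral ballI)
    fix i j assume "i \<in> {..m}" "j \<in> {..n}"
    with * have "i + j < p \<or> (m - i) + (n - j) < q" by auto
    then show "jc U i j * jc V (m - i) (n - j) = 0"
      using assms by (auto simp: order_ge_def)
  qed
qed

text \<open>Only the constant term of \<open>A\<close> contributes in the lowest degree.\<close>
lemma jc_mult_leading:
  assumes "order_ge q V" "m + n = q"
  shows "jc (A * V) m n = jc A 0 0 * jc V m n"
proof -
  have "order_ge 1 (A - cst (jc A 0 0))" by (auto simp: order_ge_def)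
  from order_ge_mult[OF this assms(1)] have "jc ((A - cst (jc A 0 0)) * V) m n = 0"
    using assms(2) by (auto simp: order_ge_def)
  then show ?thesis by (simp add: left_diff_distrib)
qed

text \<open>
  In the lowest degree \<open>Ell A\<close> acts as \<open>- A(0, 0)\<close> times the
  Laplacian. This is why solutions begin with harmonic polynomials, whatever \<open>a\<close>
  is.
\<close>
lemma jc_Ell_leading:
  assumes "order_ge (m + n + 2) U"
  shows "jc (Ell A U) m n = - jc A 0 0 *
     (real (m + 1) * real (m + 2) * jc U (m + 2) n + real (n + 1) * real (n + 2) * jc U m (n + 2))"
proof -
  have x: "order_ge (m + n + 1) (Dx U)" and y: "order_ge (m + n + 1) (Dy U)"
    using assms by (auto simp: order_ge_def)
  show ?thesis
    using jc_mult_leading[OF x, of "Suc m" n A] jc_mult_leading[OF y, of m "Suc n" A]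
    by (simp add: Ell_def algebra_simps)
qed

text \<open>
  The value at the base point of the mixed derivative of order \<open>(m, n)\<close> of a
  series.
\<close>
definition jet_deriv :: "real fps fps \<Rightarrow> nat \<Rightarrow> nat \<Rightarrow> real" where
  "jet_deriv U m n = fact m * fact n * jc U m n"

lemma jet_deriv_Ell_leading:
  assumes "order_ge (m + n + 2) U"
  shows "jet_deriv (Ell A U) m n = - jc A 0 0 * (jet_deriv U (m + 2) n + jet_deriv U m (n + 2))"
  unfolding jet_deriv_def jc_Ell_leading[OF assms] by (simp add: algebra_simps)

text \<open>
  Uniqueness in graded form: if the Cauchy data and the right-hand side vanish to the
  appropriate order, then so does the solution. In each degree the coefficients with \<open>m
  \<ge> 2\<close> follow from those with smaller \<open>m\<close> by the leading part of the
  equation.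
\<close>
lemma order_ge_Cauchy:
  assumes a: "jc A 0 0 \<noteq> 0"
    and V1: "\<And>m n. m \<le> 1 \<Longrightarrow> m + n < K \<Longrightarrow> jc U m n = 0"
    and F: "order_ge (K - 2) (Ell A U)"
  shows "order_ge K U"
proof -
  have "N \<le> K \<Longrightarrow> order_ge N U" for N
  proof (induction N)
    case (Suc N)
    then have ord: "order_ge N U" by simp
    have "jc U m n = 0" if "m + n = N" for m n
      using that
    proof (induction m arbitrary: n rule: less_induct)
      case (less m)
      show ?case
      proof (cases "m \<le> 1")
        case True then show ?thesis using V1 less.prems Suc.prems by simp
      next
        case False
        define i where "i = m - 2"
        have m: "m = i + 2" using False by (simp add: i_def)
        have "jc (Ell A U) i n = 0"
          using F less.prems Suc.prems by (intro order_geD[of "K - 2"]) (auto simp: m)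
        moreover have "jc U i (n + 2) = 0"
          using less.IH[of i "n+2"] less.prems by (simp add: m)
        ultimately show ?thesis
          using jc_Ell_leading[of i n U A] ord less.prems a by (simp add: m)
      qed
    qed
    then show ?case using ord by (auto simp: order_ge_def less_Suc_eq)
  qed (simp add: order_ge_def)
  then show ?thesis by simp
qed

definition cauchy_solution :: "real fps fps \<Rightarrow> real fps fps \<Rightarrow> real fps fps \<Rightarrow> real fps fps" where
  "cauchy_solution A D F = (SOME U. fps_nth U 0 = fps_nth D 0 \<and> fps_nth U 1 = fps_nth D 1 \<and> Ell A U = F)"

lemma cauchy_solution:
  assumes "jc A 0 0 \<noteq> 0"
  shows "m \<le> 1 \<Longrightarrow> jc (cauchy_solution A D F) m n = jc D m n" "Ell A (cauchy_solution A D F) = F"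
  using someI_ex[OF formal_solution_exists[OF assms, of D F]] unfolding cauchy_solution_def[symmetric]
  by (cases m; auto)+

definition taylor_monomial :: "nat \<Rightarrow> nat \<Rightarrow> real fps fps" where
  "taylor_monomial m n = Abs_fps (\<lambda>i. Abs_fps (\<lambda>j. if i = m \<and> j = n then 1 / (fact m * fact n) else 0))"

lemma jet_deriv_taylor_monomial: "jet_deriv (taylor_monomial m n) i j = (if i = m \<and> j = n then 1 else 0)"
  by (simp add: jet_deriv_def taylor_monomial_def)

text \<open>
  The fundamental solutions: \<open>Gsol A m n\<close> has the single Cauchy datum \<open>(m,
  n)\<close> and zero right-hand side, \<open>Qsol A m n\<close> has zero Cauchy data and a
  single nonzero derivative of the right-hand side.
\<close>
definition Gsol :: "real fps fps \<Rightarrow> nat \<Rightarrow> nat \<Rightarrow> real fps fps" where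
  "Gsol A m n = cauchy_solution A (taylor_monomial m n) 0"

definition Qsol :: "real fps fps \<Rightarrow> nat \<Rightarrow> nat \<Rightarrow> real fps fps" where
  "Qsol A m n = cauchy_solution A 0 (taylor_monomial m n)"

lemma jet_deriv_0 [simp]: "jet_deriv 0 m n = 0"
  and jet_deriv_add: "jet_deriv (U + V) m n = jet_deriv U m n + jet_deriv V m n"
  and jet_deriv_diff: "jet_deriv (U - V) m n = jet_deriv U m n - jet_deriv V m n"
  and jet_deriv_eq_0_iff: "jet_deriv U m n = 0 \<longleftrightarrow> jc U m n = 0"
  by (simp_all add: jet_deriv_def algebra_simps)

lemma jet_deriv_cst_mult: "jet_deriv (cst c * U) m n = c * jet_deriv U m n"
  by (simp add: jet_deriv_def)

lemma jet_deriv_sum: "jet_deriv (sum F S) m n = (\<Sum>s\<in>S. jet_deriv (F s) m n)"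
  by (simp add: jet_deriv_def jc_sum sum_distrib_left)

context
  fixes A :: "real fps fps"
  assumes a0: "jc A 0 0 \<noteq> 0"
begin

lemma Gsol: "Ell A (Gsol A m n) = 0"
    "i \<le> 1 \<Longrightarrow> jet_deriv (Gsol A m n) i j = (if i = m \<and> j = n then 1 else 0)"
  using cauchy_solution[OF a0] jet_deriv_taylor_monomial[of m n i j] by (auto simp: Gsol_def jet_deriv_def)

lemma Qsol: "Ell A (Qsol A m n) = taylor_monomial m n" "i \<le> 1 \<Longrightarrow> jet_deriv (Qsol A m n) i j = 0"
  using cauchy_solution[OF a0] by (auto simp: Qsol_def jet_deriv_def)

lemma order_ge_Gsol: "order_ge (m + n) (Gsol A m n)"
  by (rule order_ge_Cauchy[OF a0]) (auto simp: Gsol order_ge_def simp flip: jet_deriv_eq_0_iff)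

lemma order_ge_Qsol: "order_ge (m + n + 2) (Qsol A m n)"
  by (rule order_ge_Cauchy[OF a0]) (auto simp: Qsol jet_deriv_taylor_monomial order_ge_def simp flip: jet_deriv_eq_0_iff)

text \<open>
  The leading part is the homogeneous harmonic polynomial with the given Cauchy datum, since the
  leading part of the equation alternates signs: each step by two in \<open>x\<close> trades
  \<open>\<partial>x^2\<close> for \<open>- \<partial>y^2\<close>.
\<close>
lemma Gsol_leading:
  assumes "m \<le> 1" "i + j = m + n"
  shows "jet_deriv (Gsol A m n) i j = (if m \<le> i \<and> even (i - m) then (-1) ^ ((i - m) div 2) else 0)"
  using assms(2)
proof (induction i arbitrary: j rule: less_induct)
  case (less i)
  show ?case
  proof (cases "i \<le> 1")
    case True
    then show ?thesis using less.prems assms(1) by (auto simp: Gsol le_Suc_eq)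
  next
    case False
    define k where "k = i - 2"
    have i: "i = k + 2" using False by (simp add: k_def)
    have "order_ge (k + j + 2) (Gsol A m n)"
      using order_ge_Gsol[of m n] less.prems by (simp add: i)
    from jet_deriv_Ell_leading[OF this, of A] have "jet_deriv (Gsol A m n) i j = - jet_deriv (Gsol A m n) k (j + 2)"
      using a0 by (simp add: Gsol i)
    also have "\<dots> = - (if m \<le> k \<and> even (k - m) then (-1) ^ ((k - m) div 2) else 0)"
      using less.IH[of k "j + 2"] less.prems by (simp add: i)
    also have "\<dots> = (if m \<le> i \<and> even (i - m) then (-1) ^ ((i - m) div 2) else 0)"
      using assms(1) by (auto simp: i Suc_diff_le le_Suc_eq not_le)
    finally show ?thesis .
  qed
qed

text \<open>
  The same alternation, started by the inhomogeneity: the step from \<open>i = m\<close> to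
  \<open>i = m + 2\<close> creates the value \<open>- 1 / A(0, 0)\<close>.
\<close>
lemma Qsol_leading:
  assumes "i + j = m + n + 2"
  shows "jet_deriv (Qsol A m n) i j = (if m < i \<and> even (i - m)
     then (-1) ^ ((i - m) div 2) / jc A 0 0 else 0)"
  using assms
proof (induction i arbitrary: j rule: less_induct)
  case (less i)
  show ?case
  proof (cases "i \<le> 1")
    case True
    then show ?thesis using less.prems by (auto simp: Qsol le_Suc_eq)
  next
    case False
    define k where "k = i - 2"
    have i: "i = k + 2" using False by (simp add: k_def)
    have j: "k + j = m + n" using less.prems by (simp add: i)
    have "order_ge (k + j + 2) (Qsol A m n)"
      using order_ge_Qsol[of m n] less.prems by (simp add: i)
    from jet_deriv_Ell_leading[OF this, of A] have "jet_deriv (Qsol A m n) i j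
        = - jet_deriv (Qsol A m n) k (j + 2) - (if k = m then 1 else 0) / jc A 0 0"
      using a0 j by (auto simp: Qsol i jet_deriv_taylor_monomial field_simps)
    also have "jet_deriv (Qsol A m n) k (j + 2) = (if m < k \<and> even (k - m) then (-1) ^ ((k - m) div 2) / jc A 0 0 else 0)"
      using less.IH[of k "j + 2"] less.prems by (simp add: i)
    also have "- \<dots> - (if k = m then 1 else 0) / jc A 0 0 
       = (if m < i \<and> even (i - m) then (-1) ^ ((i - m) div 2) / jc A 0 0 else 0)"
      by (cases "m < k"; cases "m = k"; cases "m = Suc k")
         (auto simp: i Suc_diff_le le_Suc_eq not_le)
    finally show ?thesis .
  qed
qed

text \<open>
  The difference has vanishing Cauchy data and vanishing right-hand side up to the relevant
  degrees, so that the graded uniqueness lemma applies.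
\<close>
lemma jet_expansion:
  "order_ge (K + 1) (U - ((\<Sum>(m,n)\<in>LamV1 K. cst (jet_deriv U m n) * Gsol A m n)
     + (\<Sum>(m,n)\<in>{(m,n). m + n + 2 \<le> K}. cst (jet_deriv (Ell A U) m n) * Qsol A m n)))"
  (is "order_ge _ (U - (?S + ?T))")
proof (rule order_ge_Cauchy[OF a0])
  have fin: "finite (LamV1 K)" "finite {(m,n). m + n + 2 \<le> K}"
    by (rule finite_subset[of _ "{..K} \<times> {..K}"]; auto simp: LamV1_def Lam_def)+
  {
    fix m n :: nat assume *: "m \<le> 1" "m + n < K + 1"
    then have mn: "(m, n) \<in> LamV1 K" by (auto simp: LamV1_def Lam_def)
    have "jet_deriv ?S m n = (\<Sum>p\<in>LamV1 K. if p = (m, n) then jet_deriv U m n else 0)"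
      unfolding jet_deriv_sum using * by (intro sum.cong refl) (auto simp: jet_deriv_cst_mult Gsol split: if_splits)
    also have "\<dots> = jet_deriv U m n" using fin mn by simp
    finally have S: "jet_deriv ?S m n = jet_deriv U m n" .
    have T: "jet_deriv ?T m n = 0"
      unfolding jet_deriv_sum by (rule sum.neutral) (use * in \<open>auto simp: jet_deriv_cst_mult Qsol\<close>)
    show "jc (U - (?S + ?T)) m n = 0"
      unfolding jet_deriv_eq_0_iff[symmetric] by (simp only: jet_deriv_add jet_deriv_diff S T)
  }
  have ES: "Ell A ?S = 0"
    unfolding case_prod_unfold Ell_sum by (simp add: Gsol)
  have ET: "Ell A ?T = (\<Sum>(m,n)\<in>{(m,n). m + n + 2 \<le> K}. cst (jet_deriv (Ell A U) m n) * taylor_monomial m n)"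
    unfolding case_prod_unfold Ell_sum by (simp add: Qsol)
  have "jet_deriv (Ell A ?T) m n = jet_deriv (Ell A U) m n" if "m + n + 2 \<le> K" for m n
  proof -
    have "jet_deriv (Ell A ?T) m n = (\<Sum>p\<in>{(m,n). m + n + 2 \<le> K}. if p = (m, n) then jet_deriv (Ell A U) m n else 0)"
      unfolding ET jet_deriv_sum by (intro sum.cong refl) (auto simp: jet_deriv_cst_mult jet_deriv_taylor_monomial split: if_splits)
    also have "\<dots> = jet_deriv (Ell A U) m n" using fin that by simp
    finally show ?thesis .
  qed
  then show "order_ge (K + 1 - 2) (Ell A (U - (?S + ?T)))"
    unfolding order_ge_def jet_deriv_eq_0_iff[symmetric] by (auto simp: Ell_diff Ell_add ES jet_deriv_diff jet_deriv_add)
qed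

end

section \<open>Calculus with smooth functions of two variables\<close>

lemma slice_nhds:
  fixes x y :: real
  assumes "open U" "(x, y) \<in> U"
  shows "\<forall>\<^sub>F s in nhds x. (s, y) \<in> U" "\<forall>\<^sub>F t in nhds y. (x, t) \<in> U"
proof -
  have "open ((\<lambda>s. (s, y)) -` U)" "open ((\<lambda>t. (x, t)) -` U)"
    using assms(1) by (auto intro!: open_vimage continuous_intros)
  from eventually_nhds_in_open[OF this(1), of x] eventually_nhds_in_open[OF this(2), of y]
  show "\<forall>\<^sub>F s in nhds x. (s, y) \<in> U" "\<forall>\<^sub>F t in nhds y. (x, t) \<in> U"
    using assms(2) by simp_all
qed

lemma partials_cong:
  fixes x y :: real
  assumes "open U" "(x, y) \<in> U" and eq: "\<And>x y. (x, y) \<in> U \<Longrightarrow> F x y = G x y"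
  shows "((\<lambda>s. F s y) has_real_derivative d) (at x) \<longleftrightarrow> ((\<lambda>s. G s y) has_real_derivative d) (at x)"
    "((\<lambda>t. F x t) has_real_derivative d) (at y) \<longleftrightarrow> ((\<lambda>t. G x t) has_real_derivative d) (at y)"
  using slice_nhds[OF assms(1,2)]
  by (intro DERIV_cong_ev refl; auto elim!: eventually_mono dest: eq)+

lemma pdx_cong: 
  assumes "open U" "\<And>x y. (x, y) \<in> U \<Longrightarrow> F x y = G x y" "(x, y) \<in> U"
  shows "pdx F x y = pdx G x y"
  using partials_cong(1)[of U x y F G, OF assms(1,3,2)] by (simp add: pdx_def deriv_def)

lemma pdy_cong: 
  assumes "open U" "\<And>x y. (x, y) \<in> U \<Longrightarrow> F x y = G x y" "(x, y) \<in> U"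
  shows "pdy F x y = pdy G x y"
  using partials_cong(2)[of U x y F G, OF assms(1,3,2)] by (simp add: pdy_def deriv_def)

lemma C_k_on_cong:
  assumes "open U"
  shows "(\<And>x y. (x, y) \<in> U \<Longrightarrow> F x y = G x y) \<Longrightarrow> C_k_on k U F \<Longrightarrow> C_k_on k U G"
proof (induction k arbitrary: F G)
  case 0
  have "continuous_on U (\<lambda>(x, y). F x y) = continuous_on U (\<lambda>(x, y). G x y)"
    by (rule continuous_on_cong[OF refl]) (auto dest: 0(1))
  then show ?case using 0(2) by simp
next
  case (Suc k)
  have "continuous_on U (\<lambda>(x, y). F x y) = continuous_on U (\<lambda>(x, y). G x y)"
    by (rule continuous_on_cong[OF refl]) (auto dest: Suc.prems(1))
  then have "continuous_on U (\<lambda>(x, y). G x y)"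
    using Suc.prems(2) by simp
  moreover have "\<forall>(x, y)\<in>U. (\<lambda>s. G s y) differentiable (at x) \<and> (\<lambda>t. G x t) differentiable (at y)"
  proof safe
    fix x y assume xy: "(x, y) \<in> U"
    have "(\<lambda>s. F s y) differentiable (at x)" "(\<lambda>t. F x t) differentiable (at y)"
      using Suc.prems(2) xy by auto
    then show "(\<lambda>s. G s y) differentiable (at x)" "(\<lambda>t. G x t) differentiable (at y)"
      unfolding real_differentiable_def
      using partials_cong[of U x y F G, OF assms xy Suc.prems(1)] by simp_all
  qed
  moreover have "C_k_on k U (pdx G)"
    by (rule Suc.IH[of "pdx F" "pdx G"])
       (use Suc.prems(2) pdx_cong[OF assms Suc.prems(1)] in auto)
  moreover have "C_k_on k U (pdy G)"
    by (rule Suc.IH[of "pdy F" "pdy G"])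
       (use Suc.prems(2) pdy_cong[OF assms Suc.prems(1)] in auto)
  ultimately show ?case by simp
qed

lemma pdx_eqI: "((\<lambda>s. F s y) has_real_derivative d) (at x) \<Longrightarrow> pdx F x y = d"
  and pdy_eqI: "((\<lambda>t. F x t) has_real_derivative d) (at y) \<Longrightarrow> pdy F x y = d"
  by (simp_all add: pdx_def pdy_def DERIV_imp_deriv)

text \<open>
  Partial derivatives known on the open set \<open>U\<close> suffice, since
  \<open>C_k_on\<close> sees only values on \<open>U\<close>.
\<close>
lemma C_k_on_SucI:
  assumes "open U" "continuous_on U (\<lambda>(x, y). F x y)"
    and "\<And>x y. (x, y) \<in> U \<Longrightarrow> ((\<lambda>s. F s y) has_real_derivative P x y) (at x)"
    and "\<And>x y. (x, y) \<in> U \<Longrightarrow> ((\<lambda>t. F x t) has_real_derivative Q x y) (at y)"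
    and "C_k_on k U P" "C_k_on k U Q"
  shows "C_k_on (Suc k) U F"
proof -
  have "C_k_on k U (pdx F)"
    by (rule C_k_on_cong[OF assms(1) _ assms(5)]) (simp add: pdx_eqI[OF assms(3)])
  moreover have "C_k_on k U (pdy F)"
    by (rule C_k_on_cong[OF assms(1) _ assms(6)]) (simp add: pdy_eqI[OF assms(4)])
  moreover have "(\<lambda>s. F s y) differentiable (at x)" "(\<lambda>t. F x t) differentiable (at y)"
    if "(x, y) \<in> U" for x y
    using assms(3,4)[OF that] by (auto simp: real_differentiable_def)
  ultimately show ?thesis
    using assms(2) by auto
qed

lemma C_k_on_SucD:
  assumes "C_k_on (Suc k) U F" "(x, y) \<in> U"
  shows "((\<lambda>s. F s y) has_real_derivative pdx F x y) (at x)"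
    "((\<lambda>t. F x t) has_real_derivative pdy F x y) (at y)"
  using assms by (auto simp: pdx_def pdy_def DERIV_deriv_iff_real_differentiable)

lemma C_k_on_continuous: "C_k_on k U F \<Longrightarrow> continuous_on U (\<lambda>(x, y). F x y)"
  by (cases k) auto

lemma C_k_on_mono_Suc: "C_k_on (Suc k) U F \<Longrightarrow> C_k_on k U F"
proof (induction k arbitrary: F)
  case (Suc k)
  have "C_k_on k U (pdx F)" "C_k_on k U (pdy F)"
    using Suc.prems by (auto intro: Suc.IH simp only: C_k_on.simps(2)[of "Suc k"])
  then show ?case
    using Suc.prems by simp
qed simp

lemma C_k_on_const: "open U \<Longrightarrow> C_k_on k U (\<lambda>x y. c)"
proof (induction k arbitrary: c)
  case (Suc k)
  show ?case
    by (rule C_k_on_SucI[OF Suc.prems _ _ _ Suc.IH[OF Suc.prems, of 0] Suc.IH[OF Suc.prems, of 0]])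
       (simp_all add: case_prod_unfold)
qed (simp add: case_prod_unfold)

lemma C_k_on_add:
  assumes "open U"
  shows "C_k_on k U F \<Longrightarrow> C_k_on k U G \<Longrightarrow> C_k_on k U (\<lambda>x y. F x y + G x y)"
proof (induction k arbitrary: F G)
  case 0
  then show ?case by (auto simp: case_prod_unfold intro!: continuous_intros)
next
  case (Suc k)
  show ?case
  proof (rule C_k_on_SucI[OF assms])
    show "continuous_on U (\<lambda>(x, y). F x y + G x y)"
      using Suc.prems[THEN C_k_on_continuous] by (auto simp: case_prod_unfold intro!: continuous_intros)
    show "C_k_on k U (\<lambda>x y. pdx F x y + pdx G x y)" "C_k_on k U (\<lambda>x y. pdy F x y + pdy G x y)"
      using Suc.prems by (auto intro!: Suc.IH)
  qed (rule DERIV_add; rule C_k_on_SucD[OF Suc.prems(1)] C_k_on_SucD[OF Suc.prems(2)]; assumption)+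
qed

lemma C_k_on_mult:
  assumes "open U"
  shows "C_k_on k U F \<Longrightarrow> C_k_on k U G \<Longrightarrow> C_k_on k U (\<lambda>x y. F x y * G x y)"
proof (induction k arbitrary: F G)
  case 0
  then show ?case by (auto simp: case_prod_unfold intro!: continuous_intros)
next
  case (Suc k)
  show ?case
  proof (rule C_k_on_SucI[OF assms])
    show "continuous_on U (\<lambda>(x, y). F x y * G x y)"
      using Suc.prems[THEN C_k_on_continuous] by (auto simp: case_prod_unfold intro!: continuous_intros)
    show "C_k_on k U (\<lambda>x y. pdx F x y * G x y + pdx G x y * F x y)"
         "C_k_on k U (\<lambda>x y. pdy F x y * G x y + pdy G x y * F x y)"
      using Suc.prems C_k_on_mono_Suc[OF Suc.prems(1)] C_k_on_mono_Suc[OF Suc.prems(2)]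
      by (auto intro!: C_k_on_add[OF assms] Suc.IH)
  qed (rule DERIV_mult; rule C_k_on_SucD[OF Suc.prems(1)] C_k_on_SucD[OF Suc.prems(2)]; assumption)+
qed

lemma C_k_on_proj: 
  assumes "open U" shows "C_k_on k U (\<lambda>x y. x)" "C_k_on k U (\<lambda>x y. y)"
proof -
  have cont: "continuous_on U (\<lambda>(x, y). x)" "continuous_on U (\<lambda>(x, y). y)"
    unfolding case_prod_unfold
    by (rule continuous_on_fst[OF continuous_on_id], rule continuous_on_snd[OF continuous_on_id])
  have 1: "C_k_on (Suc k) U (\<lambda>x y. x)"
    by (rule C_k_on_SucI[OF assms cont(1) _ _ C_k_on_const[OF assms, of _ 1] C_k_on_const[OF assms, of _ 0]]) (rule DERIV_ident DERIV_const)+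
  have 2: "C_k_on (Suc k) U (\<lambda>x y. y)"
    by (rule C_k_on_SucI[OF assms cont(2) _ _ C_k_on_const[OF assms, of _ 0] C_k_on_const[OF assms, of _ 1]]) (rule DERIV_ident DERIV_const)+
  show "C_k_on k U (\<lambda>x y. x)" "C_k_on k U (\<lambda>x y. y)"
    by (rule C_k_on_mono_Suc[OF 1], rule C_k_on_mono_Suc[OF 2])
qed

lemma C_k_on_subset: "V \<subseteq> U \<Longrightarrow> C_k_on k U F \<Longrightarrow> C_k_on k V F"
  by (induction k arbitrary: F) (auto intro: continuous_on_subset)

lemma smooth_on_partials:
  assumes "smooth_on U F" shows "smooth_on U (pdx F)" "smooth_on U (pdy F)"
proof -
  have "C_k_on k U (pdx F) \<and> C_k_on k U (pdy F)" for k
    using assms[unfolded smooth_on_def, rule_format, of "Suc k"] by simp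
  then show "smooth_on U (pdx F)" "smooth_on U (pdy F)"
    by (simp_all add: smooth_on_def)
qed

lemma smooth_on_DERIV:
  assumes "smooth_on U F" "(x, y) \<in> U"
  shows "((\<lambda>s. F s y) has_real_derivative pdx F x y) (at x)"
    "((\<lambda>t. F x t) has_real_derivative pdy F x y) (at y)"
  using C_k_on_SucD[OF assms(1)[unfolded smooth_on_def, rule_format] assms(2)] by simp_all

lemma smooth_on_continuous: "smooth_on U F \<Longrightarrow> continuous_on U (\<lambda>(x, y). F x y)"
  unfolding smooth_on_def using C_k_on_continuous by blast

lemma smooth_on_pdy_pow: "smooth_on U F \<Longrightarrow> smooth_on U ((pdy ^^ n) F)"
  by (induction n) (auto intro: smooth_on_partials)

lemma smooth_on_ring:
  assumes "open U"
  shows "smooth_on U (\<lambda>x y. c)" "smooth_on U (\<lambda>x y. x)" "smooth_on U (\<lambda>x y. y)"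
    "smooth_on U F \<Longrightarrow> smooth_on U G \<Longrightarrow> smooth_on U (\<lambda>x y. F x y + G x y)"
    "smooth_on U F \<Longrightarrow> smooth_on U G \<Longrightarrow> smooth_on U (\<lambda>x y. F x y * G x y)"
  by (simp_all add: smooth_on_def assms C_k_on_const C_k_on_proj C_k_on_add C_k_on_mult)

lemma smooth_on_power: "open U \<Longrightarrow> smooth_on U F \<Longrightarrow> smooth_on U (\<lambda>x y. F x y ^ n)"
  by (induction n) (simp_all add: smooth_on_ring)

lemma smooth_on_sum:
  "open U \<Longrightarrow> (\<And>s. s \<in> S \<Longrightarrow> smooth_on U (F s)) \<Longrightarrow> smooth_on U (\<lambda>x y. \<Sum>s\<in>S. F s x y)"
  by (induction S rule: infinite_finite_induct) (simp_all add: smooth_on_ring)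

lemma smooth_on_subset: "smooth_on U F \<Longrightarrow> V \<subseteq> U \<Longrightarrow> smooth_on V F"
  unfolding smooth_on_def using C_k_on_subset by blast

lemma partials_ring:
  assumes "smooth_on U F" "smooth_on U G" "(x, y) \<in> U"
  shows "pdx (\<lambda>x y. F x y + G x y) x y = pdx F x y + pdx G x y"
    "pdy (\<lambda>x y. F x y + G x y) x y = pdy F x y + pdy G x y"
    "pdx (\<lambda>x y. F x y * G x y) x y = pdx F x y * G x y + F x y * pdx G x y"
    "pdy (\<lambda>x y. F x y * G x y) x y = pdy F x y * G x y + F x y * pdy G x y"
proof -
  note dF = smooth_on_DERIV[OF assms(1,3)] and dG = smooth_on_DERIV[OF assms(2,3)]
  show "pdx (\<lambda>x y. F x y + G x y) x y = pdx F x y + pdx G x y"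
    by (rule pdx_eqI) (rule DERIV_add[OF dF(1) dG(1)])
  show "pdy (\<lambda>x y. F x y + G x y) x y = pdy F x y + pdy G x y"
    by (rule pdy_eqI) (rule DERIV_add[OF dF(2) dG(2)])
  show "pdx (\<lambda>x y. F x y * G x y) x y = pdx F x y * G x y + F x y * pdx G x y"
    unfolding mult.commute[of "F x y"] by (rule pdx_eqI) (rule DERIV_mult[OF dF(1) dG(1)])
  show "pdy (\<lambda>x y. F x y * G x y) x y = pdy F x y * G x y + F x y * pdy G x y"
    unfolding mult.commute[of "F x y"] by (rule pdy_eqI) (rule DERIV_mult[OF dF(2) dG(2)])
qed

text \<open>
  The second difference over a square, expressed by a mixed derivative: the mean value theorem
  in \<open>x\<close> for \<open>F(\<cdot>, y + h) - F(\<cdot>, y)\<close>, followed by the mean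
  value theorem in \<open>y\<close>.
\<close>
lemma double_mvt:
  fixes F :: "real \<Rightarrow> real \<Rightarrow> real"
  assumes h: "h > 0"
    and P: "\<And>s t. s \<in> {x..x+h} \<Longrightarrow> t \<in> {y..y+h} \<Longrightarrow> ((\<lambda>s. F s t) has_real_derivative P s t) (at s)"
    and Q: "\<And>s t. s \<in> {x..x+h} \<Longrightarrow> t \<in> {y..y+h} \<Longrightarrow> ((\<lambda>t. P s t) has_real_derivative Q s t) (at t)"
  shows "\<exists>s\<in>{x..x+h}. \<exists>t\<in>{y..y+h}.
     F (x+h) (y+h) - F (x+h) y - F x (y+h) + F x y = h * h * Q s t"
proof -
  have "\<exists>s. x < s \<and> s < x + h \<and>
      (F (x+h) (y+h) - F (x+h) y) - (F x (y+h) - F x y) = (x + h - x) * (P s (y+h) - P s y)"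
    by (rule MVT2) (use h in \<open>auto intro!: derivative_intros P\<close>)
  then obtain s where s: "x < s" "s < x + h"
      "(F (x+h) (y+h) - F (x+h) y) - (F x (y+h) - F x y) = h * (P s (y+h) - P s y)" by auto
  have "\<exists>t. y < t \<and> t < y + h \<and> P s (y+h) - P s y = (y + h - y) * Q s t"
    by (rule MVT2) (use h s in \<open>auto intro!: Q\<close>)
  then obtain t where "y < t" "t < y + h" "P s (y+h) - P s y = h * Q s t" by auto
  with s show ?thesis by (intro bexI[of _ s] bexI[of _ t]) auto
qed

text \<open>
  Schwarz's theorem. The second difference over a small square is symmetric in the two variables
  and equals \<open>h^2\<close> times either mixed derivative at some point of the square;
  continuity then forces the two to agree.
\<close>
lemma pdx_pdy_commute:
  assumes "open U" "smooth_on U F" "(x, y) \<in> U"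
  shows "pdx (pdy F) x y = pdy (pdx F) x y"
proof (rule ccontr)
  assume ne: "pdx (pdy F) x y \<noteq> pdy (pdx F) x y"
  define e where "e = \<bar>pdx (pdy F) x y - pdy (pdx F) x y\<bar> / 2"
  have "e > 0" using ne by (simp add: e_def)
  let ?A = "\<lambda>(x, y). pdx (pdy F) x y" and ?B = "\<lambda>(x, y). pdy (pdx F) x y"
  have "isCont ?A (x, y)" "isCont ?B (x, y)"
    using assms by (meson continuous_on_eq_continuous_at smooth_on_continuous smooth_on_partials)+
  then have "\<forall>\<^sub>F p in nhds (x, y). dist (?A p) (?A (x, y)) < e"
       "\<forall>\<^sub>F p in nhds (x, y). dist (?B p) (?B (x, y)) < e"
    using \<open>e > 0\<close> unfolding isCont_def tendsto_at_iff_tendsto_nhds by (blast dest: tendstoD)+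
  moreover have "\<forall>\<^sub>F p in nhds (x, y). p \<in> U"
    using assms by (intro eventually_nhds_in_open)
  ultimately have "\<forall>\<^sub>F p in nhds (x, y). dist (?A p) (?A (x, y)) < e \<and> dist (?B p) (?B (x, y)) < e \<and> p \<in> U"
    by eventually_elim auto
  then obtain d where "d > 0" and d: "\<And>p. dist p (x, y) < d \<Longrightarrow>
      dist (?A p) (?A (x, y)) < e \<and> dist (?B p) (?B (x, y)) < e \<and> p \<in> U"
    unfolding eventually_nhds_metric by blast
  define h where "h = d / 3"
  have h: "h > 0" using \<open>d > 0\<close> by (simp add: h_def)
  have near: "dist (s, t) (x, y) < d" if "s \<in> {x..x+h}" "t \<in> {y..y+h}" for s t
  proof -
    have "dist (s, t) (x, y) \<le> \<bar>s - x\<bar> + \<bar>t - y\<bar>"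
      using norm_Pair_le[of "s - x" "t - y"] by (simp add: dist_norm)
    then show ?thesis using that h by (auto simp: h_def)
  qed
  have U: "(s, t) \<in> U" if "s \<in> {x..x+h}" "t \<in> {y..y+h}" for s t
    using d near that by blast
  obtain s t where 1: "s \<in> {x..x+h}" "t \<in> {y..y+h}"
     "F (x+h) (y+h) - F (x+h) y - F x (y+h) + F x y = h * h * pdy (pdx F) s t"
    using double_mvt[of h x y F "pdx F" "pdy (pdx F)"] h U
      smooth_on_DERIV(1)[OF assms(2)] smooth_on_DERIV(2)[OF smooth_on_partials(1)[OF assms(2)]]
    by blast
  obtain s' t' where 2: "s' \<in> {x..x+h}" "t' \<in> {y..y+h}"
     "F (x+h) (y+h) - F x (y+h) - F (x+h) y + F x y = h * h * pdx (pdy F) s' t'"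
    using double_mvt[of h y x "\<lambda>t s. F s t" "\<lambda>t s. pdy F s t" "\<lambda>t s. pdx (pdy F) s t"] h U
      smooth_on_DERIV(2)[OF assms(2)] smooth_on_DERIV(1)[OF smooth_on_partials(2)[OF assms(2)]]
    by blast
  have "h * h * pdy (pdx F) s t = h * h * pdx (pdy F) s' t'"
    using 1(3) 2(3) by linarith
  then have "pdy (pdx F) s t = pdx (pdy F) s' t'"
    using h by simp
  moreover have "\<bar>pdy (pdx F) s t - pdy (pdx F) x y\<bar> < e" "\<bar>pdx (pdy F) s' t' - pdx (pdy F) x y\<bar> < e"
    using d[OF near[OF 1(1,2)]] d[OF near[OF 2(1,2)]] by (auto simp: dist_real_def)
  ultimately show False unfolding e_def by (smt (verit) field_sum_of_halves)
qed

text \<open>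
  The chain rule along a line; total differentiability comes from the continuity of one partial
  derivative.
\<close>
lemma DERIV_along:
  assumes "open U" "smooth_on U F" "(x + k * h, y + l * h) \<in> U"
  shows "((\<lambda>h. F (x + k * h) (y + l * h)) has_real_derivative
     k * pdx F (x + k * h) (y + l * h) + l * pdy F (x + k * h) (y + l * h)) (at h)"
proof -
  define x' y' where "x' = x + k * h" and "y' = y + l * h"
  have U: "(x', y') \<in> U" using assms(3) by (simp add: x'_def y'_def)
  obtain X Y where XY: "open X" "open Y" "(x', y') \<in> X \<times> Y" "X \<times> Y \<subseteq> U"
    using open_prod_elim[OF assms(1) U] by blast
  obtain r where r: "r > 0" "ball y' r \<subseteq> Y" using XY openE by blast
  let ?fy = "\<lambda>x y. blinfun_scaleR_left (pdy F x y)"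
  have "((\<lambda>(x, y). F x y) has_derivative (\<lambda>(tx, ty). tx * pdx F x' y' + blinfun_apply (?fy x' y') ty))
      (at (x', y') within X \<times> ball y' r)"
  proof (rule has_derivative_partialsI)
    show "((\<lambda>x. F x y') has_derivative (\<lambda>tx. tx * pdx F x' y')) (at x' within X)"
      using smooth_on_DERIV(1)[OF assms(2) U]
      by (simp add: has_field_derivative_def mult_commute_abs has_derivative_at_withinI)
    show "((\<lambda>y. F x y) has_derivative blinfun_apply (?fy x y)) (at y within ball y' r)"
      if "x \<in> X" "y \<in> ball y' r" for x y
    proof -
      have "(x, y) \<in> U" using that r XY by blast
      from smooth_on_DERIV(2)[OF assms(2) this] show ?thesis
        by (simp add: has_field_derivative_def mult_commute_abs has_derivative_at_withinI)
    qed
    have "isCont (\<lambda>(x, y). pdy F x y) (x', y')"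
      using assms U by (meson continuous_on_eq_continuous_at smooth_on_continuous smooth_on_partials)
    then have "isCont (\<lambda>p. blinfun_scaleR_left ((\<lambda>(x, y). pdy F x y) p)) (x', y')"
      by (rule bounded_linear.isCont[OF bounded_linear_blinfun_scaleR_left])
    then show "continuous (at (x', y') within X \<times> ball y' r) (\<lambda>(x, y). ?fy x y)"
      by (auto simp: case_prod_unfold intro: continuous_at_imp_continuous_at_within)
  qed (use r in auto)
  then have "((\<lambda>(x, y). F x y) has_derivative (\<lambda>(tx, ty). tx * pdx F x' y' + ty * pdy F x' y')) (at (x', y'))"
    using XY r by (subst (asm) at_within_open) (auto intro!: open_Times)
  then have D: "((\<lambda>(x, y). F x y) has_derivative (\<lambda>(tx, ty). tx * pdx F x' y' + ty * pdy F x' y'))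
      (at ((\<lambda>h. (x + k * h, y + l * h)) h))" by (simp add: x'_def y'_def)
  have L: "((\<lambda>h. (x + k * h, y + l * h)) has_derivative (\<lambda>t. (k * t, l * t))) (at h)"
    by (auto intro!: derivative_eq_intros)
  have "(\<lambda>t. case (k * t, l * t) of (tx, ty) \<Rightarrow> tx * pdx F x' y' + ty * pdy F x' y')
      = (*) (k * pdx F x' y' + l * pdy F x' y')"
    by (auto simp: fun_eq_iff algebra_simps)
  then show ?thesis
    using has_derivative_compose[OF L D] unfolding has_field_derivative_def x'_def y'_def by simp
qed

lemma pow_pdy_cong:
  assumes "open U" "\<And>x y. (x, y) \<in> U \<Longrightarrow> F x y = G x y" "(x, y) \<in> U"
  shows "(pdy ^^ n) F x y = (pdy ^^ n) G x y"
  using assms(3)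
proof (induction n arbitrary: x y)
  case (Suc n)
  then show ?case unfolding funpow.simps comp_def by (intro pdy_cong[OF assms(1)])
qed (simp add: assms)

lemma pow_pdx_cong:
  assumes "open U" "\<And>x y. (x, y) \<in> U \<Longrightarrow> F x y = G x y" "(x, y) \<in> U"
  shows "(pdx ^^ n) F x y = (pdx ^^ n) G x y"
  using assms(3)
proof (induction n arbitrary: x y)
  case (Suc n)
  then show ?case unfolding funpow.simps comp_def by (intro pdx_cong[OF assms(1)])
qed (simp add: assms)

lemma pd_cong:
  assumes "open U" "\<And>x y. (x, y) \<in> U \<Longrightarrow> F x y = G x y" "(x, y) \<in> U"
  shows "pd m n F x y = pd m n G x y"
  unfolding pd_def by (intro pow_pdx_cong[OF assms(1)] pow_pdy_cong[OF assms(1)] assms)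

text \<open>
  As \<open>pd m n\<close> applies the \<open>y\<close>-derivatives first, this is what makes
  \<open>pd m n (pdx F)\<close> equal to \<open>pd (m + 1) n F\<close>.
\<close>
lemma pow_pdy_pdx:
  assumes "open U" "smooth_on U F" "(x, y) \<in> U"
  shows "(pdy ^^ n) (pdx F) x y = pdx ((pdy ^^ n) F) x y"
  using assms(3)
proof (induction n arbitrary: x y)
  case (Suc n)
  have "(pdy ^^ Suc n) (pdx F) x y = pdy (pdx ((pdy ^^ n) F)) x y"
    using pdy_cong[OF assms(1) Suc.IH Suc.prems] by simp
  also have "\<dots> = pdx ((pdy ^^ Suc n) F) x y"
    using pdx_pdy_commute[OF assms(1) smooth_on_pdy_pow[OF assms(2)] Suc.prems] by simp
  finally show ?case .
qed simp

section \<open>The jet of a smooth function\<close>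

definition jet :: "real \<Rightarrow> real \<Rightarrow> (real \<Rightarrow> real \<Rightarrow> real) \<Rightarrow> real fps fps" where
  "jet x0 y0 F = Abs_fps (\<lambda>m. Abs_fps (\<lambda>n. pd m n F x0 y0 / (fact m * fact n)))"

lemma jc_jet: "jc (jet x0 y0 F) m n = pd m n F x0 y0 / (fact m * fact n)"
  by (simp add: jet_def)

lemma jet_deriv_jet [simp]: "jet_deriv (jet x0 y0 F) m n = pd m n F x0 y0"
  by (simp add: jet_def jet_deriv_def)

context
  fixes U :: "(real \<times> real) set" and x0 y0 :: real
  assumes U: "open U" "(x0, y0) \<in> U"
begin

lemma jet_cong: "(\<And>x y. (x, y) \<in> U \<Longrightarrow> F x y = G x y) \<Longrightarrow> jet x0 y0 F = jet x0 y0 G"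
  unfolding jet_def by (intro fps_ext) (simp add: pd_cong[OF U(1) _ U(2), of F G])

lemma jet_pdx: "smooth_on U F \<Longrightarrow> jet x0 y0 (pdx F) = Dx (jet x0 y0 F)"
proof (rule jet_eqI)
  fix m n assume F: "smooth_on U F"
  have "pd m n (pdx F) x0 y0 = (pdx ^^ m) (pdx ((pdy ^^ n) F)) x0 y0"
    unfolding pd_def by (rule pow_pdx_cong[OF U(1) pow_pdy_pdx[OF U(1) F] U(2)])
  also have "\<dots> = pd (Suc m) n F x0 y0"
    by (simp add: pd_def funpow_swap1)
  finally show "jc (jet x0 y0 (pdx F)) m n = jc (Dx (jet x0 y0 F)) m n"
    by (simp add: jc_jet divide_simps)
qed

lemma jet_pdy: "jet x0 y0 (pdy F) = Dy (jet x0 y0 F)"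
  by (rule jet_eqI) (simp add: jc_jet pd_def funpow_swap1 divide_simps)

text \<open>
  An induction scheme on the total degree. To show that the jet of \<open>T F G\<close> (such as
  \<open>F * G\<close>) is \<open>R F G\<close> (the product of the jets), compare constant
  terms, and reduce degree \<open>N + 1\<close> to degree \<open>N\<close> for the two first
  derivatives. Thus the Leibniz formula for higher derivatives follows from the product rule for
  first derivatives.
\<close>
lemma jet_operation_eqI:
  assumes S: "\<And>F G. P F G \<Longrightarrow> smooth_on U (T F G)"
    and zero: "\<And>F G. P F G \<Longrightarrow> jc (R F G) 0 0 = T F G x0 y0"
    and step: "\<And>F G N. P F G \<Longrightarrow> (\<And>F G m n. P F G \<Longrightarrow> m + n = N \<Longrightarrow> jc (jet x0 y0 (T F G)) m n = jc (R F G) m n)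
       \<Longrightarrow> (\<forall>m n. m + n = N \<longrightarrow> jc (jet x0 y0 (pdx (T F G))) m n = jc (Dx (R F G)) m n
                      \<and> jc (jet x0 y0 (pdy (T F G))) m n = jc (Dy (R F G)) m n)"
    and P: "P F G"
  shows "jet x0 y0 (T F G) = R F G"
proof (rule jet_eqI)
  have "P F G \<Longrightarrow> m + n = N \<Longrightarrow> jc (jet x0 y0 (T F G)) m n = jc (R F G) m n" for F G m n N
  proof (induction N arbitrary: F G m n)
    case 0
    then show ?case using zero[of F G] by (simp add: jc_jet pd_def)
  next
    case (Suc N)
    note st = step[OF Suc.prems(1) Suc.IH, rule_format]
    show ?case
    proof (cases m)
      case (Suc m')
      then have "m' + n = N" using Suc.prems by simp
      from st[OF _ _ this] show ?thesis
        using jet_pdx[OF S[OF Suc.prems(1)]] by (simp add: Suc del: of_nat_Suc)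
    next
      case 0
      then obtain n' where n': "n = Suc n'" using Suc.prems by (cases n) auto
      then have "m + n' = N" using Suc.prems by simp
      from st[OF _ _ this] show ?thesis
        using jet_pdy[of "T F G"] by (simp add: n' del: of_nat_Suc)
    qed
  qed
  then show "jc (jet x0 y0 (T F G)) m n = jc (R F G) m n" for m n using P by blast
qed

lemma jet_add:
  assumes "smooth_on U F" "smooth_on U G"
  shows "jet x0 y0 (\<lambda>x y. F x y + G x y) = jet x0 y0 F + jet x0 y0 G"
proof (rule jet_operation_eqI[where P = "\<lambda>F G. smooth_on U F \<and> smooth_on U G"
      and R = "\<lambda>F G. jet x0 y0 F + jet x0 y0 G" and T = "\<lambda>F G x y. F x y + G x y"])
  fix F G N
  assume FG: "smooth_on U F \<and> smooth_on U G"
    and IH: "\<And>F G m n. smooth_on U F \<and> smooth_on U G \<Longrightarrow> m + n = N \<Longrightarrow>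
        jc (jet x0 y0 (\<lambda>x y. F x y + G x y)) m n = jc (jet x0 y0 F + jet x0 y0 G) m n"
  have x: "jet x0 y0 (pdx (\<lambda>x y. F x y + G x y)) = jet x0 y0 (\<lambda>x y. pdx F x y + pdx G x y)"
    and y: "jet x0 y0 (pdy (\<lambda>x y. F x y + G x y)) = jet x0 y0 (\<lambda>x y. pdy F x y + pdy G x y)"
    using FG by (auto intro!: jet_cong partials_ring)
  show "\<forall>m n. m + n = N \<longrightarrow>
     jc (jet x0 y0 (pdx (\<lambda>x y. F x y + G x y))) m n = jc (Dx (jet x0 y0 F + jet x0 y0 G)) m n \<and>
     jc (jet x0 y0 (pdy (\<lambda>x y. F x y + G x y))) m n = jc (Dy (jet x0 y0 F + jet x0 y0 G)) m n"
    using FG smooth_on_partials[of U F] smooth_on_partials[of U G]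
    unfolding x y by (simp add: IH jet_pdx jet_pdy del: jc_Dx jc_Dy)
next
  show "smooth_on U F \<and> smooth_on U G" using assms ..
next
  fix F G assume FG: "smooth_on U F \<and> smooth_on U G"
  show "smooth_on U (\<lambda>x y. F x y + G x y)"
    by (rule smooth_on_ring(4)[OF U(1) conjunct1[OF FG] conjunct2[OF FG]])
  show "jc (jet x0 y0 F + jet x0 y0 G) 0 0 = F x0 y0 + G x0 y0"
    by (simp add: jc_jet pd_def)
qed

lemma jet_mult:
  assumes "smooth_on U F" "smooth_on U G"
  shows "jet x0 y0 (\<lambda>x y. F x y * G x y) = jet x0 y0 F * jet x0 y0 G"
proof (rule jet_operation_eqI[where P = "\<lambda>F G. smooth_on U F \<and> smooth_on U G"
      and R = "\<lambda>F G. jet x0 y0 F * jet x0 y0 G" and T = "\<lambda>F G x y. F x y * G x y"])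
  fix F G N
  assume FG: "smooth_on U F \<and> smooth_on U G"
    and IH: "\<And>F G m n. smooth_on U F \<and> smooth_on U G \<Longrightarrow> m + n = N \<Longrightarrow>
        jc (jet x0 y0 (\<lambda>x y. F x y * G x y)) m n = jc (jet x0 y0 F * jet x0 y0 G) m n"
  note sm = conjunct1[OF FG] conjunct2[OF FG] 
    smooth_on_partials[OF conjunct1[OF FG]] smooth_on_partials[OF conjunct2[OF FG]]
  have x: "jet x0 y0 (pdx (\<lambda>x y. F x y * G x y))
      = jet x0 y0 (\<lambda>x y. pdx F x y * G x y) + jet x0 y0 (\<lambda>x y. F x y * pdx G x y)"
    unfolding jet_add[OF smooth_on_ring(5)[OF U(1) sm(3,2)] smooth_on_ring(5)[OF U(1) sm(1,5)], symmetric]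
    by (rule jet_cong, rule partials_ring(3)[OF sm(1,2)], assumption)
  have y: "jet x0 y0 (pdy (\<lambda>x y. F x y * G x y))
      = jet x0 y0 (\<lambda>x y. pdy F x y * G x y) + jet x0 y0 (\<lambda>x y. F x y * pdy G x y)"
    unfolding jet_add[OF smooth_on_ring(5)[OF U(1) sm(4,2)] smooth_on_ring(5)[OF U(1) sm(1,6)], symmetric]
    by (rule jet_cong, rule partials_ring(4)[OF sm(1,2)], assumption)
  show "\<forall>m n. m + n = N \<longrightarrow>
     jc (jet x0 y0 (pdx (\<lambda>x y. F x y * G x y))) m n = jc (Dx (jet x0 y0 F * jet x0 y0 G)) m n \<and>
     jc (jet x0 y0 (pdy (\<lambda>x y. F x y * G x y))) m n = jc (Dy (jet x0 y0 F * jet x0 y0 G)) m n"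
  proof (intro allI impI)
    fix m n assume mn: "m + n = N"
    show "jc (jet x0 y0 (pdx (\<lambda>x y. F x y * G x y))) m n = jc (Dx (jet x0 y0 F * jet x0 y0 G)) m n \<and>
     jc (jet x0 y0 (pdy (\<lambda>x y. F x y * G x y))) m n = jc (Dy (jet x0 y0 F * jet x0 y0 G)) m n"
      unfolding x y Dx_mult Dy_mult fps_add_nth
        IH[OF conjI[OF sm(3,2)] mn] IH[OF conjI[OF sm(1,5)] mn]
        IH[OF conjI[OF sm(4,2)] mn] IH[OF conjI[OF sm(1,6)] mn]
        jet_pdx[OF sm(1)] jet_pdx[OF sm(2)] jet_pdy by simp
  qed
next
  show "smooth_on U F \<and> smooth_on U G" using assms ..
next
  fix F G assume FG: "smooth_on U F \<and> smooth_on U G"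
  show "smooth_on U (\<lambda>x y. F x y * G x y)"
    by (rule smooth_on_ring(5)[OF U(1) conjunct1[OF FG] conjunct2[OF FG]])
  show "jc (jet x0 y0 F * jet x0 y0 G) 0 0 = F x0 y0 * G x0 y0"
    by (simp add: jc_jet pd_def)
qed

lemma jet_const: "jet x0 y0 (\<lambda>x y. c) = cst c"
proof -
  have z: "pdx (\<lambda>x y. 0) = (\<lambda>x y. 0)" "pdy (\<lambda>x y. 0) = (\<lambda>x y. 0)"
    by (auto simp: pdx_def pdy_def)
  have "jet x0 y0 (\<lambda>x y. 0) = 0"
  proof (rule jet_eqI)
    fix m n show "jc (jet x0 y0 (\<lambda>x y. 0)) m n = jc 0 m n"
    proof -
      have "(pdy ^^ n) (\<lambda>x y. 0) = (\<lambda>x y. 0)" by (induction n) (auto simp: z)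
      moreover have "(pdx ^^ m) (\<lambda>x y. 0) = (\<lambda>x y. 0)" by (induction m) (auto simp: z)
      ultimately show ?thesis by (simp add: jc_jet pd_def)
    qed
  qed
  moreover have "pdx (\<lambda>x y. c) = (\<lambda>x y. 0)" "pdy (\<lambda>x y. c) = (\<lambda>x y. 0)"
    by (auto simp: pdx_def pdy_def)
  ultimately have "Dx (jet x0 y0 (\<lambda>x y. c)) = 0" "Dy (jet x0 y0 (\<lambda>x y. c)) = 0"
    using jet_pdx[OF smooth_on_ring(1)[OF U(1)], of c] jet_pdy[of "\<lambda>x y. c"] by simp_all
  then show ?thesis
    by - (rule jet_eqI_deriv; simp add: jc_jet pd_def)
qed

lemma jet_minus:
  assumes "smooth_on U F" shows "jet x0 y0 (\<lambda>x y. - F x y) = - jet x0 y0 F"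
proof -
  have "jet x0 y0 (\<lambda>x y. - 1 * F x y) = cst (-1) * jet x0 y0 F"
    using assms jet_mult[OF smooth_on_ring(1)[OF U(1), of "-1"], of F] by (simp add: jet_const)
  also have "\<dots> = - jet x0 y0 F" by (rule jet_eqI) simp
  finally show ?thesis by simp
qed

lemma jet_elliptic:
  assumes "smooth_on U a" "smooth_on U u"
  shows "jet x0 y0 (elliptic a u) = Ell (jet x0 y0 a) (jet x0 y0 u)"
proof -
  note sm = assms smooth_on_partials[OF assms(2)]
  have smx: "smooth_on U (\<lambda>x y. a x y * pdx u x y)" "smooth_on U (\<lambda>x y. a x y * pdy u x y)"
    by (intro smooth_on_ring U sm)+
  note sm' = smooth_on_partials(1)[OF smx(1)] smooth_on_partials(2)[OF smx(2)]
  have "jet x0 y0 (elliptic a u) = - jet x0 y0 (\<lambda>x y. pdx (\<lambda>x y. a x y * pdx u x y) x y + pdy (\<lambda>x y. a x y * pdy u x y) x y)"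
    unfolding elliptic_def by (rule jet_minus) (intro smooth_on_ring U sm')
  also have "\<dots> = Ell (jet x0 y0 a) (jet x0 y0 u)"
    unfolding Ell_def using sm' smx sm by (simp add: jet_add jet_pdx jet_pdy jet_mult)
  finally show ?thesis .
qed

lemma jet_sum:
  "(\<And>s. s \<in> S \<Longrightarrow> smooth_on U (F s)) \<Longrightarrow> jet x0 y0 (\<lambda>x y. \<Sum>s\<in>S. F s x y) = (\<Sum>s\<in>S. jet x0 y0 (F s))"
proof (induction S rule: infinite_finite_induct)
  case (insert s S)
  have 1: "smooth_on U (F s)" by (rule insert.prems) simp
  have S: "smooth_on U (F t)" if "t \<in> S" for t by (rule insert.prems) (use that in simp)
  have 2: "smooth_on U (\<lambda>x y. \<Sum>s\<in>S. F s x y)"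
    by (rule smooth_on_sum[OF U(1)]) (rule S)
  have 3: "jet x0 y0 (\<lambda>x y. \<Sum>s\<in>S. F s x y) = (\<Sum>s\<in>S. jet x0 y0 (F s))"
    by (rule insert.IH) (rule S)
  show ?case
    unfolding sum.insert[OF insert.hyps] using jet_add[OF 1 2] by (simp only: 3)
next
  case (infinite A)
  then show ?case using jet_const[of 0] by (simp add: cst_def)
next
  case empty
  then show ?case using jet_const[of 0] by (simp add: cst_def)
qed

lemma jet_power: "smooth_on U F \<Longrightarrow> jet x0 y0 (\<lambda>x y. F x y ^ n) = jet x0 y0 F ^ n"
proof (induction n)
  case 0
  then show ?case using jet_const[of 1] by (simp add: cst_def)
next
  case (Suc n)
  show ?case
    using jet_mult[OF Suc.prems smooth_on_power[OF U(1) Suc.prems], of n] by (simp add: Suc.IH[OF Suc.prems])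
qed

lemma smooth_on_shift: "smooth_on U (\<lambda>x y. x - c)" "smooth_on U (\<lambda>x y. y - c)"
  using smooth_on_ring(4)[OF U(1) smooth_on_ring(2)[OF U(1)] smooth_on_ring(1)[OF U(1), of "-c"]]
    smooth_on_ring(4)[OF U(1) smooth_on_ring(3)[OF U(1)] smooth_on_ring(1)[OF U(1), of "-c"]]
  by simp_all

lemma jet_proj: 
  shows "jet x0 y0 (\<lambda>x y. x - x0) = fps_X" "jet x0 y0 (\<lambda>x y. y - y0) = fps_const fps_X"
proof -
  note s = smooth_on_shift
  have d: "pdx (\<lambda>x y. x - x0) = (\<lambda>x y. 1)" "pdy (\<lambda>x y. x - x0) = (\<lambda>x y. 0)"
      "pdx (\<lambda>x y. y - y0) = (\<lambda>x y. 0)" "pdy (\<lambda>x y. y - y0) = (\<lambda>x y. 1)"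
    by (intro ext pdx_eqI pdy_eqI; auto intro!: derivative_eq_intros)+
  have X: "Dx fps_X = cst 1" "Dy fps_X = cst 0" "Dx (fps_const fps_X) = cst 0" "Dy (fps_const fps_X) = cst 1"
    by (auto intro!: jet_eqI simp: fps_X_def)
  have "Dx (jet x0 y0 (\<lambda>x y. x - x0)) = cst 1" "Dy (jet x0 y0 (\<lambda>x y. x - x0)) = cst 0"
    using jet_pdx[OF s(1)[of x0]] jet_pdy[of "\<lambda>x y. x - x0"] by (simp_all only: d jet_const)
  then show "jet x0 y0 (\<lambda>x y. x - x0) = fps_X"
    by - (rule jet_eqI_deriv; simp add: X jc_jet pd_def)
  have "Dx (jet x0 y0 (\<lambda>x y. y - y0)) = cst 0" "Dy (jet x0 y0 (\<lambda>x y. y - y0)) = cst 1"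
    using jet_pdx[OF s(2)[of y0]] jet_pdy[of "\<lambda>x y. y - y0"] by (simp_all only: d jet_const)
  then show "jet x0 y0 (\<lambda>x y. y - y0) = fps_const fps_X"
    by - (rule jet_eqI_deriv; simp add: X jc_jet pd_def)
qed

end

definition taylor_poly :: "nat \<Rightarrow> real fps fps \<Rightarrow> real \<Rightarrow> real \<Rightarrow> real" where
  "taylor_poly K V x y = (\<Sum>(m, n)\<in>Lam K. jc V m n * x ^ m * y ^ n)"

lemma finite_Lam [simp]: "finite (Lam K)"
  by (rule finite_subset[of _ "{..K} \<times> {..K}"]) (auto simp: Lam_def)

text \<open>
  A polynomial is built from constants and coordinate functions, whose jets are known, so its
  jet is given by the ring structure. In this way any prescribed derivatives up to a given order
  are realised.
\<close>
lemma smooth_taylor_poly: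
  "smooth_on UNIV (\<lambda>x y. taylor_poly K V (x - x0) (y - y0))"
  "jc (jet x0 y0 (\<lambda>x y. taylor_poly K V (x - x0) (y - y0))) m n = (if m + n \<le> K then jc V m n else 0)"
proof -
  note U = open_UNIV UNIV_I[of "(x0, y0)"]
  note s = smooth_on_power[OF U(1) smooth_on_shift(1)[OF U, of x0]] 
    smooth_on_power[OF U(1) smooth_on_shift(2)[OF U, of y0]]
  let ?M = "\<lambda>p x y. jc V (fst p) (snd p) * (x - x0) ^ fst p * (y - y0) ^ snd p"
  have s1: "smooth_on UNIV (\<lambda>x y. jc V (fst p) (snd p) * (x - x0) ^ fst p)" for p
    by (rule smooth_on_ring(5)[OF U(1) smooth_on_ring(1)[OF U(1)] s(1)])
  have s2: "smooth_on UNIV (?M p)" for p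
    by (rule smooth_on_ring(5)[OF U(1) s1 s(2)])
  show "smooth_on UNIV (\<lambda>x y. taylor_poly K V (x - x0) (y - y0))"
    unfolding taylor_poly_def case_prod_unfold by (rule smooth_on_sum[OF U(1) s2])
  have "jet x0 y0 (?M p) = cst (jc V (fst p) (snd p)) * fps_X ^ fst p * fps_const fps_X ^ snd p" for p
    unfolding jet_mult[OF U s1 s(2)] jet_mult[OF U smooth_on_ring(1)[OF U(1)] s(1)]
      jet_power[OF U smooth_on_shift(1)[OF U]] jet_power[OF U smooth_on_shift(2)[OF U]]
      jet_const[OF U] jet_proj[OF U] ..
  then have "jet x0 y0 (\<lambda>x y. taylor_poly K V (x - x0) (y - y0)) =
     (\<Sum>p\<in>Lam K. cst (jc V (fst p) (snd p)) * fps_X ^ fst p * fps_const fps_X ^ snd p)"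
    unfolding taylor_poly_def case_prod_unfold by (simp only: jet_sum[OF U s2])
  also have "jc \<dots> m n = (\<Sum>p\<in>Lam K. if p = (m, n) then jc V m n else 0)"
    unfolding jc_sum
    by (intro sum.cong refl)
       (auto simp: fps_const_power fps_X_power_mult_right_nth mult.assoc cst_def fps_X_power_nth)
  also have "\<dots> = (if m + n \<le> K then jc V m n else 0)"
    by (simp add: sum.delta) (simp add: Lam_def)
  finally show "jc (jet x0 y0 (\<lambda>x y. taylor_poly K V (x - x0) (y - y0))) m n = (if m + n \<le> K then jc V m n else 0)" .
qed

section \<open>Taylor's theorem along rays\<close>

text \<open>
  Integration of a one-sided estimate of the derivative, by the mean value theorem.
\<close>
lemma bigo_integrate:
  fixes g g' :: "real \<Rightarrow> real"
  assumes d: "\<forall>\<^sub>F t in nhds 0. (g has_real_derivative g' t) (at t)"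
    and g0: "g 0 = 0" and O: "g' \<in> O[at_right 0](\<lambda>h. h ^ N)"
  shows "g \<in> O[at_right 0](\<lambda>h. h ^ Suc N)"
proof -
  obtain c where c: "c > 0" "\<forall>\<^sub>F h in at_right 0. norm (g' h) \<le> c * norm (h ^ N)"
    using O by (auto elim: landau_o.bigE)
  then obtain b where b: "b > 0" "\<And>h. 0 < h \<Longrightarrow> h < b \<Longrightarrow> \<bar>g' h\<bar> \<le> c * \<bar>h ^ N\<bar>"
    by (auto simp: eventually_at_right_field)
  obtain r where r: "r > 0" "\<And>t. \<bar>t\<bar> < r \<Longrightarrow> (g has_real_derivative g' t) (at t)"
    using d by (auto simp: eventually_nhds_metric dist_real_def)
  have "\<bar>g h\<bar> \<le> c * \<bar>h ^ Suc N\<bar>" if h: "0 < h" "h < min b r" for h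
  proof -
    have "\<exists>z. 0 < z \<and> z < h \<and> g h - g 0 = (h - 0) * g' z"
      by (rule MVT2) (use h r in auto)
    then obtain z where z: "0 < z" "z < h" "g h = h * g' z" using g0 by auto
    have "\<bar>g' z\<bar> \<le> c * z ^ N" using b(2)[of z] z h by auto
    also have "\<dots> \<le> c * h ^ N" using z c(1) by (intro mult_left_mono power_mono) auto
    finally have "h * \<bar>g' z\<bar> \<le> h * (c * h ^ N)" using h by (intro mult_left_mono) auto
    then show ?thesis using z h by (simp add: abs_mult mult_ac)
  qed
  then have "\<forall>\<^sub>F h in at_right 0. norm (g h) \<le> c * norm (h ^ Suc N)"
    using b(1) r(1) by (auto simp: eventually_at_right_field intro!: exI[of _ "min b r"])
  then show ?thesis by (rule landau_o.bigI[OF c(1)])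
qed

text \<open>
  Induction on \<open>N\<close> for all smooth functions at once: the derivative in
  \<open>h\<close> of the left-hand side for \<open>F\<close> is the left-hand side for the
  directional derivative \<open>D\<close> of \<open>F\<close> with one term less, because
  differentiation commutes with \<open>along\<close>.
\<close>
theorem taylor_along:
  assumes U: "open U" "(x0, y0) \<in> U" and F: "smooth_on U F"
  shows "(\<lambda>h. F (x0 + k * h) (y0 + l * h) - (\<Sum>j<N. fps_nth (along k l (jet x0 y0 F)) j * h ^ j))
     \<in> O[at_right 0](\<lambda>h. h ^ N)"
  using F
proof (induction N arbitrary: F)
  case 0
  have "isCont (\<lambda>h. F (x0 + k * h) (y0 + l * h)) 0"
    by (rule DERIV_isCont[OF DERIV_along[OF U(1) 0]]) (use U in simp)
  then have "((\<lambda>h. F (x0 + k * h) (y0 + l * h)) \<longlongrightarrow> F x0 y0) (at_right 0)"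
    unfolding isCont_def by (auto intro: filterlim_at_split[THEN iffD1, THEN conjunct2])
  then show ?case
    by (intro bigoI_tendsto[where c = "F x0 y0"]) simp_all
next
  case (Suc N)
  define c where "c = fps_nth (along k l (jet x0 y0 F))"
  define D where "D = (\<lambda>x y. k * pdx F x y + l * pdy F x y)"
  have sD: "smooth_on U D" unfolding D_def
    by (intro smooth_on_ring(4,5) smooth_on_ring(1) U smooth_on_partials Suc.prems)
  have "jet x0 y0 D = Dir k l (jet x0 y0 F)"
    unfolding D_def Dir_def
    using smooth_on_ring(5)[OF U(1) smooth_on_ring(1)[OF U(1)] smooth_on_partials(1)[OF Suc.prems]]
      smooth_on_ring(5)[OF U(1) smooth_on_ring(1)[OF U(1)] smooth_on_partials(2)[OF Suc.prems]]
    by (simp add: jet_add[OF U] jet_mult[OF U smooth_on_ring(1)[OF U(1)]] smooth_on_partials[OF Suc.prems]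
         jet_const[OF U] jet_pdx[OF U Suc.prems] jet_pdy[OF U])
  then have c': "fps_nth (along k l (jet x0 y0 D)) j = real (Suc j) * c (Suc j)" for j
    unfolding c_def by (simp flip: fps_deriv_along)
  have "open ((\<lambda>h. (x0 + k * h, y0 + l * h)) -` U)"
    using U(1) by (auto intro!: open_vimage continuous_intros)
  then have ev: "\<forall>\<^sub>F h in nhds 0. (x0 + k * h, y0 + l * h) \<in> U"
    using eventually_nhds_in_open[of _ "0::real"] U(2) by fastforce
  show ?case
    unfolding c_def[symmetric]
  proof (rule bigo_integrate)
    show "F (x0 + k * 0) (y0 + l * 0) - (\<Sum>j<Suc N. c j * 0 ^ j) = 0"
      by (simp add: sum.lessThan_Suc_shift c_def jc_jet pd_def del: sum.lessThan_Suc)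
    show "(\<lambda>h. D (x0 + k * h) (y0 + l * h)
         - (\<Sum>j<N. fps_nth (along k l (jet x0 y0 D)) j * h ^ j)) \<in> O[at_right 0](\<lambda>h. h ^ N)"
      by (rule Suc.IH[OF sD])
    show "\<forall>\<^sub>F t in nhds 0. ((\<lambda>h. F (x0 + k * h) (y0 + l * h) - (\<Sum>j<Suc N. c j * h ^ j))
       has_real_derivative D (x0 + k * t) (y0 + l * t)
         - (\<Sum>j<N. fps_nth (along k l (jet x0 y0 D)) j * t ^ j)) (at t)"
      using ev
    proof eventually_elim
      case (elim t)
      have "((\<lambda>h. \<Sum>j<Suc N. c j * h ^ j) has_real_derivative (\<Sum>j<Suc N. c j * (real j * t ^ (j - 1)))) (at t)"
        by (auto intro!: derivative_eq_intros sum.cong simp del: sum.lessThan_Suc)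
      also have "(\<Sum>j<Suc N. c j * (real j * t ^ (j - 1)))
          = (\<Sum>j<N. fps_nth (along k l (jet x0 y0 D)) j * t ^ j)"
        by (simp add: sum.lessThan_Suc_shift c' mult_ac del: sum.lessThan_Suc)
      finally show ?case
        unfolding D_def by (intro DERIV_diff DERIV_along[OF U(1) Suc.prems elim])
    qed
  qed
qed

lemma along_taylor_poly: "taylor_poly K V (k * h) (l * h) = (\<Sum>j\<le>K. fps_nth (along k l V) j * h ^ j)"
proof -
  have "taylor_poly K V (k * h) (l * h) = (\<Sum>(j, i)\<in>Sigma {..K} (\<lambda>j. {..j}). jc V i (j - i) * (k * h) ^ i * (l * h) ^ (j - i))"
    unfolding taylor_poly_def
    by (rule sum.reindex_bij_witness[of _ "\<lambda>(j, i). (i, j - i)" "\<lambda>(m, n). (m + n, m)"]) (auto simp: Lam_def)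
  also have "\<dots> = (\<Sum>j\<le>K. \<Sum>i\<le>j. jc V i (j - i) * (k * h) ^ i * (l * h) ^ (j - i))"
    by (simp add: sum.Sigma)
  also have "\<dots> = (\<Sum>j\<le>K. fps_nth (along k l V) j * h ^ j)"
    unfolding along_def fps_nth_Abs_fps sum_distrib_right
    by (intro sum.cong refl) (auto simp: power_mult_distrib simp flip: power_add)
  finally show ?thesis .
qed

section \<open>The stencil polynomials as Taylor polynomials of formal solutions\<close>

context
  fixes a :: "real \<Rightarrow> real \<Rightarrow> real" and U :: "(real \<times> real) set" and x0 y0 :: real
    and A :: "real fps fps"
  assumes U: "open U" "(x0, y0) \<in> U" and a: "smooth_on U a" and apos: "a x0 y0 \<noteq> 0"
    and A_def: "A = jet x0 y0 a"
begin

lemma A0: "jc A 0 0 = a x0 y0"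
  by (simp add: A_def jc_jet pd_def)

lemma A0_neq_0: "jc A 0 0 \<noteq> 0"
  using apos by (simp add: A0)

lemma smooth_near_on:
  assumes "smooth_near u x0 y0"
  obtains W where "open W" "(x0, y0) \<in> W" "W \<subseteq> U" "smooth_on W u" "smooth_on W a"
proof -
  obtain V where V: "open V" "(x0, y0) \<in> V" "smooth_on V u"
    using assms by (auto simp: smooth_near_def)
  show ?thesis
    by (rule that[of "U \<inter> V"]) (use U V a in \<open>auto intro: smooth_on_subset\<close>)
qed

lemma jet_elliptic_near:
  assumes "smooth_near u x0 y0"
  shows "jet x0 y0 (elliptic a u) = Ell A (jet x0 y0 u)"
proof -
  from assms obtain W where "open W" "(x0, y0) \<in> W" "W \<subseteq> U" "smooth_on W u" "smooth_on W a"
    by (rule smooth_near_on)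
  then show ?thesis unfolding A_def by (intro jet_elliptic[of W])
qed

text \<open>
  Zero outside the index sets, which is the normalisation in \<open>V_expansion\<close>.
\<close>
definition Gcoef :: "nat \<Rightarrow> nat \<Rightarrow> nat \<Rightarrow> nat \<times> nat \<Rightarrow> real" where
  "Gcoef M m' n' p = (if p \<in> idx_u M m' n' then jet_deriv (Gsol A (fst p) (snd p)) m' n' else 0)"

definition Qcoef :: "nat \<Rightarrow> nat \<Rightarrow> nat \<Rightarrow> nat \<times> nat \<Rightarrow> real" where
  "Qcoef M m' n' p = (if p \<in> idx_f M m' n' then jet_deriv (Qsol A (fst p) (snd p)) m' n' else 0)"

lemma V_expansion_exists:
  assumes "m' + n' \<le> M + 1"
  shows "V_expansion a x0 y0 M m' n' (Gcoef M m' n') (Qcoef M m' n')"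
  unfolding V_expansion_def
proof (intro conjI allI impI)
  fix u assume u: "smooth_near u x0 y0"
  let ?V = "jet x0 y0 u" and ?K = "m' + n'"
  have iu: "idx_u M m' n' = LamV1 ?K" and jf: "idx_f M m' n' = {(m,n). m + n + 2 \<le> ?K}"
    using assms by (auto simp: idx_u_def idx_f_def LamV1_def Lam_def)
  have "jet_deriv (?V - ((\<Sum>(m,n)\<in>LamV1 ?K. cst (jet_deriv ?V m n) * Gsol A m n)
     + (\<Sum>(m,n)\<in>{(m,n). m + n + 2 \<le> ?K}. cst (jet_deriv (Ell A ?V) m n) * Qsol A m n))) m' n' = 0"
    unfolding jet_deriv_eq_0_iff by (rule order_geD[OF jet_expansion[OF A0_neq_0]]) simp
  then have "jet_deriv ?V m' n' = (\<Sum>(m,n)\<in>LamV1 ?K. jet_deriv ?V m n * jet_deriv (Gsol A m n) m' n')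
     + (\<Sum>(m,n)\<in>{(m,n). m + n + 2 \<le> ?K}. jet_deriv (Ell A ?V) m n * jet_deriv (Qsol A m n) m' n')"
    by (simp add: jet_deriv_diff jet_deriv_add jet_deriv_sum case_prod_unfold jet_deriv_cst_mult)
  then show "pd m' n' u x0 y0 =
       (\<Sum>(m, n)\<in>idx_u M m' n'. Gcoef M m' n' (m, n) * pd m n u x0 y0) +
       (\<Sum>(m, n)\<in>idx_f M m' n'. Qcoef M m' n' (m, n) * pd m n (elliptic a u) x0 y0)"
    unfolding jet_elliptic_near[OF u, symmetric] jet_deriv_jet iu[symmetric] jf[symmetric]
    by (simp add: Gcoef_def Qcoef_def case_prod_unfold mult.commute cong: sum.cong)
qed (auto simp: Gcoef_def Qcoef_def)

text \<open>
  \<open>Ell\<close> is of second order, so its derivatives up to order \<open>K\<close> see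
  only those of order \<open>K + 2\<close>.
\<close>
lemma Ell_cong:
  assumes "\<And>m n. m + n \<le> K + 2 \<Longrightarrow> jc V m n = jc W m n" "m + n \<le> K"
  shows "jc (Ell B V) m n = jc (Ell B W) m n"
proof -
  have "order_ge (K + 3) (V - W)" using assms by (auto simp: order_ge_def)
  then have "order_ge (K + 2) (Dx (V - W))" "order_ge (K + 2) (Dy (V - W))"
    by (auto simp: order_ge_def)
  moreover have "order_ge 0 B" by (simp add: order_ge_def)
  ultimately have "order_ge (0 + (K + 2)) (B * Dx (V - W))" "order_ge (0 + (K + 2)) (B * Dy (V - W))"
    by (blast intro: order_ge_mult)+
  then have "jc (Ell B (V - W)) m n = 0"
    using assms(2) unfolding Ell_def by (auto simp: order_ge_def simp del: Dx_diff Dy_diff)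
  then show ?thesis by (simp add: Ell_diff)
qed

text \<open>
  Fundamental solutions are only formal. Up to any finite order they can nevertheless be
  replaced by polynomials, and the definitions that quantify over smooth functions can be tested
  on these.
\<close>
lemma realise:
  obtains u where "smooth_near u x0 y0" "\<And>m n. m + n \<le> K + 2 \<Longrightarrow> pd m n u x0 y0 = jet_deriv V m n"
    "\<And>m n. m + n \<le> K \<Longrightarrow> pd m n (elliptic a u) x0 y0 = jet_deriv (Ell A V) m n"
proof -
  let ?u = "\<lambda>x y. taylor_poly (K + 2) V (x - x0) (y - y0)"
  have sm: "smooth_near ?u x0 y0"
    unfolding smooth_near_def using smooth_taylor_poly(1) by blast
  have eq: "jc (jet x0 y0 ?u) m n = jc V m n" if "m + n \<le> K + 2" for m n
    using that by (simp add: smooth_taylor_poly(2))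
  show ?thesis
  proof (rule that[OF sm])
    fix m n assume "m + n \<le> K + 2"
    from eq[OF this] show "pd m n ?u x0 y0 = jet_deriv V m n"
      unfolding jet_deriv_jet[symmetric] jet_deriv_def by simp
  next
    fix m n assume "m + n \<le> K"
    from Ell_cong[OF eq this] show "pd m n (elliptic a ?u) x0 y0 = jet_deriv (Ell A V) m n"
      unfolding jet_deriv_jet[symmetric] jet_elliptic_near[OF sm] jet_deriv_def by simp
  qed
qed

text \<open>
  Inserting a polynomial with the derivatives of \<open>Gsol A m n\<close> or \<open>Qsol A m
  n\<close> leaves a single term on the right-hand side, which isolates one coefficient.
\<close>
lemma V_expansion_unique:
  assumes "V_expansion a x0 y0 M m' n' B C"
  shows "B = Gcoef M m' n'" "C = Qcoef M m' n'"
proof -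
  have fin: "finite (idx_u M m' n')" "finite (idx_f M m' n')"
    by (rule finite_subset[OF _ finite_Lam[of "M + 1"]]; auto simp: idx_u_def idx_f_def LamV1_def Lam_def)+
  note exp = assms[unfolded V_expansion_def, THEN conjunct2, THEN conjunct2, rule_format]
  note zero = assms[unfolded V_expansion_def, THEN conjunct1, rule_format]
    assms[unfolded V_expansion_def, THEN conjunct2, THEN conjunct1, rule_format]
  define K where "K = M + m' + n'"
  have K: "m' + n' \<le> K + 2" "\<And>m n. (m, n) \<in> idx_u M m' n' \<Longrightarrow> m + n \<le> K + 2"
      "\<And>m n. (m, n) \<in> idx_f M m' n' \<Longrightarrow> m + n \<le> K"
    by (auto simp: K_def idx_u_def idx_f_def)
  show "B = Gcoef M m' n'"
  proof
    fix p
    show "B p = Gcoef M m' n' p"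
    proof (cases "p \<in> idx_u M m' n'")
      case True
      obtain m n where p: "p = (m, n)" by (cases p)
      obtain u where u: "smooth_near u x0 y0"
        "\<And>i j. i + j \<le> K + 2 \<Longrightarrow> pd i j u x0 y0 = jet_deriv (Gsol A m n) i j"
        "\<And>i j. i + j \<le> K \<Longrightarrow> pd i j (elliptic a u) x0 y0 = jet_deriv (Ell A (Gsol A m n)) i j"
        using realise[of K "Gsol A m n"] by blast
      have "(\<Sum>(i, j)\<in>idx_u M m' n'. B (i, j) * pd i j u x0 y0)
          = (\<Sum>q\<in>idx_u M m' n'. if q = p then B p else 0)"
        by (intro sum.cong refl)
           (auto simp: p u(2)[OF K(2)] Gsol[OF A0_neq_0] idx_u_def LamV1_def split: if_splits)
      moreover have "(\<Sum>(i, j)\<in>idx_f M m' n'. C (i, j) * pd i j (elliptic a u) x0 y0) = 0"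
        by (intro sum.neutral) (auto simp: u(3)[OF K(3)] Gsol[OF A0_neq_0])
      ultimately show ?thesis
        using exp[OF u(1)] u(2)[OF K(1)] True unfolding sum.delta[OF fin(1)] by (simp add: Gcoef_def p)
    qed (simp add: zero Gcoef_def)
  qed
  show "C = Qcoef M m' n'"
  proof
    fix p
    show "C p = Qcoef M m' n' p"
    proof (cases "p \<in> idx_f M m' n'")
      case True
      obtain m n where p: "p = (m, n)" by (cases p)
      obtain u where u: "smooth_near u x0 y0"
        "\<And>i j. i + j \<le> K + 2 \<Longrightarrow> pd i j u x0 y0 = jet_deriv (Qsol A m n) i j"
        "\<And>i j. i + j \<le> K \<Longrightarrow> pd i j (elliptic a u) x0 y0 = jet_deriv (Ell A (Qsol A m n)) i j"
        using realise[of K "Qsol A m n"] by blast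
      have "(\<Sum>(i, j)\<in>idx_f M m' n'. C (i, j) * pd i j (elliptic a u) x0 y0)
          = (\<Sum>q\<in>idx_f M m' n'. if q = p then C p else 0)"
        by (intro sum.cong refl) (auto simp: p u(3)[OF K(3)] Qsol[OF A0_neq_0] jet_deriv_taylor_monomial split: if_splits)
      moreover have "(\<Sum>(i, j)\<in>idx_u M m' n'. B (i, j) * pd i j u x0 y0) = 0"
        by (intro sum.neutral) (auto simp: u(2)[OF K(2)] Qsol[OF A0_neq_0] idx_u_def LamV1_def)
      ultimately show ?thesis
        using exp[OF u(1)] u(2)[OF K(1)] True unfolding sum.delta[OF fin(2)] by (simp add: Qcoef_def p)
    qed (simp add: zero Qcoef_def)
  qed
qed

lemma V_expansion_the:
  assumes "m' + n' \<le> M + 1"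
  shows "(THE (B, C). V_expansion a x0 y0 M m' n' B C) = (Gcoef M m' n', Qcoef M m' n')"
proof (rule the_equality)
  show "case (Gcoef M m' n', Qcoef M m' n') of (B, C) \<Rightarrow> V_expansion a x0 y0 M m' n' B C"
    unfolding split_conv by (rule V_expansion_exists[OF assms])
next
  fix P assume *: "case P of (B, C) \<Rightarrow> V_expansion a x0 y0 M m' n' B C"
  obtain B C where P: "P = (B, C)" by (cases P)
  have "V_expansion a x0 y0 M m' n' B C" using * unfolding P split_conv .
  from V_expansion_unique[OF this] show "P = (Gcoef M m' n', Qcoef M m' n')"
    unfolding P by (rule arg_cong2[of _ _ _ _ Pair])
qed

lemma AVu_eq: "m' + n' \<le> M + 1 \<Longrightarrow> (m, n) \<in> idx_u M m' n' \<Longrightarrow> AVu a x0 y0 M m' n' m n = jet_deriv (Gsol A m n) m' n'"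
  and AVf_eq: "m' + n' \<le> M + 1 \<Longrightarrow> (m, n) \<in> idx_f M m' n' \<Longrightarrow> AVf a x0 y0 M m' n' m n = jet_deriv (Qsol A m n) m' n'"
  by (simp_all add: AVu_def AVf_def V_expansion_the Gcoef_def Qcoef_def)

text \<open>
  The first sum in \<open>GV\<close> is the part of lowest degree of \<open>Gsol\<close>, a
  harmonic polynomial. In higher degrees \<open>Gsol\<close> has no terms with exponent
  \<open>0\<close> or \<open>1\<close> of \<open>x\<close>, as its other Cauchy data vanish;
  only indices in \<open>LamV2\<close> remain.
\<close>
lemma GV_eq:
  assumes "(m, n) \<in> LamV1 (M + 1)"
  shows "GV a x0 y0 M m n x y = taylor_poly (M + 1) (Gsol A m n) x y"
proof -
  let ?t = "\<lambda>(i, j). jc (Gsol A m n) i j * x ^ i * y ^ j"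
  let ?I1 = "{(i, j). i + j = m + n}" and ?I2 = "{(i, j) \<in> LamV2 (M + 1). i + j > m + n}"
  have mn: "m \<le> 1" "m + n \<le> M + 1" using assms by (auto simp: LamV1_def Lam_def)
  have fin: "finite ?I1" "finite ?I2"
    by (rule finite_subset[OF _ finite_Lam[of "M + 1"]]; use mn in \<open>auto simp: LamV2_def Lam_def\<close>)+
  have "taylor_poly (M + 1) (Gsol A m n) x y = sum ?t (?I1 \<union> ?I2)"
    unfolding taylor_poly_def
  proof (rule sum.mono_neutral_right)
    show "?I1 \<union> ?I2 \<subseteq> Lam (M + 1)" using mn by (auto simp: LamV2_def Lam_def)
    show "\<forall>p\<in>Lam (M + 1) - (?I1 \<union> ?I2). ?t p = 0"
    proof
      fix p assume p: "p \<in> Lam (M + 1) - (?I1 \<union> ?I2)"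
      obtain i j where ij: "p = (i, j)" by (cases p)
      from p consider "i + j < m + n" | "i \<le> 1" "(i, j) \<noteq> (m, n)"
        unfolding ij by (fastforce simp: LamV2_def LamV1_def Lam_def)
      then have "jc (Gsol A m n) i j = 0"
        using order_ge_Gsol[OF A0_neq_0, of m n] Gsol(2)[OF A0_neq_0, of i m n j]
        by cases (auto simp: order_ge_def simp flip: jet_deriv_eq_0_iff)
      then show "?t p = 0" by (simp add: ij)
    qed
  qed simp
  also have "\<dots> = sum ?t ?I1 + sum ?t ?I2"
    by (rule sum.union_disjoint[OF fin]) auto
  also have "sum ?t ?I1 = (\<Sum>l = 0..n div 2. ?t (m + 2 * l, n - 2 * l))"
  proof -
    have "sum ?t ?I1 = sum ?t ((\<lambda>l. (m + 2 * l, n - 2 * l)) ` {0..n div 2})"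
    proof (rule sum.mono_neutral_right[OF fin(1)])
      show "\<forall>p\<in>?I1 - (\<lambda>l. (m + 2 * l, n - 2 * l)) ` {0..n div 2}. ?t p = 0"
      proof
        fix p assume *: "p \<in> ?I1 - (\<lambda>l. (m + 2 * l, n - 2 * l)) ` {0..n div 2}"
        obtain i j where p: "p = (i, j)" by (cases p)
        have ij: "i + j = m + n" "(i, j) \<notin> (\<lambda>l. (m + 2 * l, n - 2 * l)) ` {0..n div 2}" using * p by auto
        have "\<not> (m \<le> i \<and> even (i - m))"
        proof
          assume *: "m \<le> i \<and> even (i - m)"
          then obtain l where "i - m = 2 * l" by blast
          then have "i = m + 2 * l" "j = n - 2 * l" "l \<le> n div 2" using * ij(1) by auto
          then show False using ij(2) by auto
        qed
        then have "jet_deriv (Gsol A m n) i j = 0" by (subst Gsol_leading[OF A0_neq_0 mn(1) ij(1)]) (rule if_not_P)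
        then show "?t p = 0" by (simp add: p jet_deriv_eq_0_iff)
      qed
    qed auto
    also have "\<dots> = (\<Sum>l = 0..n div 2. ?t (m + 2 * l, n - 2 * l))"
      by (subst sum.reindex) (auto simp: inj_on_def)
    finally show ?thesis .
  qed
  also have "\<dots> = (\<Sum>l = 0..n div 2. (-1) ^ l * x ^ (m + 2 * l) * y ^ (n - 2 * l)
                          / (fact (m + 2 * l) * fact (n - 2 * l)))"
  proof (intro sum.cong refl)
    fix l assume "l \<in> {0..n div 2}"
    then have "jet_deriv (Gsol A m n) (m + 2 * l) (n - 2 * l) = (-1) ^ l"
      by (subst Gsol_leading[OF A0_neq_0 mn(1)]) auto
    then have "jc (Gsol A m n) (m + 2 * l) (n - 2 * l) = (-1) ^ l / (fact (m + 2 * l) * fact (n - 2 * l))"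
      by (simp add: jet_deriv_def field_simps)
    then show "?t (m + 2 * l, n - 2 * l) = (-1) ^ l * x ^ (m + 2 * l) * y ^ (n - 2 * l)
                          / (fact (m + 2 * l) * fact (n - 2 * l))" by simp
  qed
  also have "sum ?t ?I2 = (\<Sum>(m', n') \<in> ?I2.
        AVu a x0 y0 M m' n' m n * (x ^ m' * y ^ n' / (fact m' * fact n')))"
  proof (intro sum.cong refl, safe)
    fix i j assume "(i, j) \<in> LamV2 (M + 1)" "m + n < i + j"
    then have "i + j \<le> M + 1" "(m, n) \<in> idx_u M i j"
      using assms by (auto simp: idx_u_def LamV2_def Lam_def)
    then show "jc (Gsol A m n) i j * x ^ i * y ^ j = AVu a x0 y0 M i j m n * (x ^ i * y ^ j / (fact i * fact j))"
      by (simp add: AVu_eq jet_deriv_def)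
  qed
  finally show ?thesis by (simp add: GV_def)
qed

lemma QV_eq:
  assumes "m + n + 2 \<le> M + 1"
  shows "QV a x0 y0 M m n x y = taylor_poly (M + 1) (Qsol A m n) x y"
proof -
  let ?t = "\<lambda>(i, j). jc (Qsol A m n) i j * x ^ i * y ^ j"
  let ?I1 = "{(i, j). i + j = m + n + 2}" and ?I2 = "{(i, j) \<in> LamV2 (M + 1). i + j > m + n + 2}"
  have fin: "finite ?I1" "finite ?I2"
    by (rule finite_subset[OF _ finite_Lam[of "M + 1"]]; use assms in \<open>auto simp: LamV2_def Lam_def\<close>)+
  have "taylor_poly (M + 1) (Qsol A m n) x y = sum ?t (?I1 \<union> ?I2)"
    unfolding taylor_poly_def
  proof (rule sum.mono_neutral_right)
    show "?I1 \<union> ?I2 \<subseteq> Lam (M + 1)" using assms by (auto simp: LamV2_def Lam_def)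
    show "\<forall>p\<in>Lam (M + 1) - (?I1 \<union> ?I2). ?t p = 0"
    proof
      fix p assume p: "p \<in> Lam (M + 1) - (?I1 \<union> ?I2)"
      obtain i j where ij: "p = (i, j)" by (cases p)
      from p consider "i + j < m + n + 2" | "i \<le> 1"
        unfolding ij by (fastforce simp: LamV2_def LamV1_def Lam_def)
      then have "jc (Qsol A m n) i j = 0"
        using order_ge_Qsol[OF A0_neq_0, of m n] Qsol(2)[OF A0_neq_0, of i m n j]
        by cases (auto simp: order_ge_def simp flip: jet_deriv_eq_0_iff)
      then show "?t p = 0" by (simp add: ij)
    qed
  qed simp
  also have "\<dots> = sum ?t ?I1 + sum ?t ?I2"
    by (rule sum.union_disjoint[OF fin]) auto
  also have "sum ?t ?I1 = (\<Sum>l = 1..1 + n div 2. ?t (m + 2 * l, n + 2 - 2 * l))"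
  proof -
    have "sum ?t ?I1 = sum ?t ((\<lambda>l. (m + 2 * l, n + 2 - 2 * l)) ` {1..1 + n div 2})"
    proof (rule sum.mono_neutral_right[OF fin(1)])
      show "\<forall>p\<in>?I1 - (\<lambda>l. (m + 2 * l, n + 2 - 2 * l)) ` {1..1 + n div 2}. ?t p = 0"
      proof
        fix p assume *: "p \<in> ?I1 - (\<lambda>l. (m + 2 * l, n + 2 - 2 * l)) ` {1..1 + n div 2}"
        obtain i j where p: "p = (i, j)" by (cases p)
        have ij: "i + j = m + n + 2" "(i, j) \<notin> (\<lambda>l. (m + 2 * l, n + 2 - 2 * l)) ` {1..1 + n div 2}" using * p by auto
        have "\<not> (m < i \<and> even (i - m))"
        proof
          assume *: "m < i \<and> even (i - m)"
          then obtain l where "i - m = 2 * l" by blast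
          then have "i = m + 2 * l" "j = n + 2 - 2 * l" "1 \<le> l" "l \<le> 1 + n div 2" using * ij(1) by auto
          then show False using ij(2) by auto
        qed
        then have "jet_deriv (Qsol A m n) i j = 0" by (subst Qsol_leading[OF A0_neq_0 ij(1)]) (rule if_not_P)
        then show "?t p = 0" by (simp add: p jet_deriv_eq_0_iff)
      qed
    qed auto
    also have "\<dots> = (\<Sum>l = 1..1 + n div 2. ?t (m + 2 * l, n + 2 - 2 * l))"
      by (subst sum.reindex) (auto simp: inj_on_def)
    finally show ?thesis .
  qed
  also have "\<dots> = 1 / a x0 y0 * (\<Sum>l = 1..1 + n div 2. (-1) ^ l * x ^ (m + 2 * l) * y ^ (n + 2 - 2 * l)
                          / (fact (m + 2 * l) * fact (n + 2 - 2 * l)))"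
    unfolding sum_distrib_left
  proof (intro sum.cong refl)
    fix l assume l: "l \<in> {1..1 + n div 2}"
    then have "jet_deriv (Qsol A m n) (m + 2 * l) (n + 2 - 2 * l) = (-1) ^ l / jc A 0 0"
      by (subst Qsol_leading[OF A0_neq_0]) auto
    then have "jc (Qsol A m n) (m + 2 * l) (n + 2 - 2 * l)
         = (-1) ^ l / a x0 y0 / (fact (m + 2 * l) * fact (n + 2 - 2 * l))"
      using apos by (simp add: jet_deriv_def field_simps A0)
    then show "?t (m + 2 * l, n + 2 - 2 * l) = 1 / a x0 y0 * ((-1) ^ l * x ^ (m + 2 * l) * y ^ (n + 2 - 2 * l)
                          / (fact (m + 2 * l) * fact (n + 2 - 2 * l)))" by simp
  qed
  also have "sum ?t ?I2 = (\<Sum>(m', n') \<in> ?I2.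
        AVf a x0 y0 M m' n' m n * (x ^ m' * y ^ n' / (fact m' * fact n')))"
  proof (intro sum.cong refl, safe)
    fix i j assume "(i, j) \<in> LamV2 (M + 1)" "m + n + 2 < i + j"
    then have "i + j \<le> M + 1" "(m, n) \<in> idx_f M i j"
      using assms by (auto simp: idx_f_def LamV2_def Lam_def)
    then show "jc (Qsol A m n) i j * x ^ i * y ^ j = AVf a x0 y0 M i j m n * (x ^ i * y ^ j / (fact i * fact j))"
      by (simp add: AVf_eq jet_deriv_def)
  qed
  finally show ?thesis by (simp add: QV_def)
qed

end

section \<open>A compact stencil for formal solutions\<close>

function sqrt_coeff :: "'r::comm_ring_1 fps \<Rightarrow> 'r \<Rightarrow> 'r \<Rightarrow> nat \<Rightarrow> 'r" where
  "sqrt_coeff A r i 0 = r"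
| "sqrt_coeff A r i (Suc m) =
     i * (fps_nth A (Suc m) - (\<Sum>j\<in>{1..m}. sqrt_coeff A r i j * sqrt_coeff A r i (Suc m - j)))"
  by pat_completeness auto
termination
  by (relation "inv_image less_than (\<lambda>(A, r, i, m). m)") auto

text \<open>
  Square roots of power series over a commutative ring, by comparing coefficients: the
  coefficient of \<open>s * s\<close> in degree \<open>n > 0\<close> is \<open>2 * r\<close>
  times that of \<open>s\<close> plus terms of lower index. It is needed over the reals and
  again over the ring of real power series.
\<close>
lemma fps_sqrt_exists:
  fixes A :: "'r::comm_ring_1 fps"
  assumes r: "r * r = fps_nth A 0" and i: "i * (r + r) = 1"
  shows "\<exists>s. s * s = A \<and> fps_nth s 0 = r"
proof (intro exI conjI)
  let ?s = "Abs_fps (sqrt_coeff A r i)"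
  show "fps_nth ?s 0 = r" by simp
  show "?s * ?s = A"
  proof (rule fps_ext)
    fix n
    show "fps_nth (?s * ?s) n = fps_nth A n"
    proof (cases n)
      case (Suc m)
      define T where "T = (\<Sum>j\<in>{1..m}. sqrt_coeff A r i j * sqrt_coeff A r i (Suc m - j))"
      have "{0..Suc m} = insert 0 (insert (Suc m) {1..m})" by auto
      then have "fps_nth (?s * ?s) n = sqrt_coeff A r i (Suc m) * (r + r) + T"
        unfolding Suc fps_mult_nth T_def by (simp add: algebra_simps del: sqrt_coeff.simps(2))
      also have "sqrt_coeff A r i (Suc m) * (r + r) = i * (r + r) * (fps_nth A (Suc m) - T)"
        by (simp add: T_def mult_ac)
      finally show ?thesis unfolding i Suc by simp
    qed (simp add: r)
  qed
qed

lemma jet_sqrt: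
  assumes "jc A 0 0 > 0"
  obtains s t where "s * s = A" "s * t = 1" "jc s 0 0 \<noteq> 0"
proof -
  have "sqrt (jc A 0 0) * sqrt (jc A 0 0) = jc A 0 0"
    "inverse (2 * sqrt (jc A 0 0)) * (sqrt (jc A 0 0) + sqrt (jc A 0 0)) = 1"
    using assms by (simp_all add: field_simps)
  from fps_sqrt_exists[OF this] obtain r where r: "r * r = fps_nth A 0" "fps_nth r 0 = sqrt (jc A 0 0)"
    by auto
  then have r0: "fps_nth r 0 \<noteq> 0" using assms by simp
  have "inverse (r + r) * (r + r) = 1"
    by (rule inverse_mult_eq_1) (use r0 in simp)
  from fps_sqrt_exists[OF r(1) this] obtain s where s: "s * s = A" "fps_nth s 0 = r" by auto
  have "fps_nth s 0 * inverse r = 1"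
    using inverse_mult_eq_1'[OF r0] s(2) by simp
  from fps_right_inverse[OF this] have "s * fps_right_inverse s (inverse r) = 1" .
  then show ?thesis using s r0 by (intro that[of s]) auto
qed

definition Lap :: "real fps fps \<Rightarrow> real fps fps" where
  "Lap V = Dx (Dx V) + Dy (Dy V)"

lemma Lap_add: "Lap (V + W) = Lap V + Lap W"
  by (simp add: Lap_def)

lemma cst_2: "cst 2 = 2"
  by (simp add: cst_def flip: fps_numeral_fps_const)

lemma Lap_mult: "Lap (V * W) = Lap V * W + V * Lap W + cst 2 * (Dx V * Dx W + Dy V * Dy W)"
  by (simp add: Lap_def Dx_mult Dy_mult cst_2 algebra_simps)

lemma Lap_Dx: "Lap (Dx V) = Dx (Lap V)" and Lap_Dy: "Lap (Dy V) = Dy (Lap V)"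
  by (simp_all add: Lap_def Dy_Dx)

text \<open>
  The Liouville substitution. With \<open>v = s * U\<close> the flux is \<open>A * grad U = s *
  grad v - v * grad s\<close>, and in its divergence the products of gradients cancel, leaving
  \<open>s * Lap v - v * Lap s\<close>.
\<close>
lemma Lap_sqrt_substitution:
  assumes s: "s * s = A" "s * t = 1" and U: "Ell A U = 0"
  shows "Lap (s * U) = (t * Lap s) * (s * U)"
proof -
  define v where "v = s * U"
  have eq: "A * Dx U = s * Dx v - v * Dx s" "A * Dy U = s * Dy v - v * Dy s"
    by (simp_all add: v_def Dx_mult Dy_mult s(1)[symmetric] algebra_simps)
  have "Dx (A * Dx U) + Dy (A * Dy U) = s * Lap v - v * Lap s"
    unfolding eq Lap_def by (simp add: Dx_mult Dy_mult algebra_simps)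
  then have "s * Lap v = v * Lap s" using U by (simp add: Ell_def)
  then have "t * (s * Lap v) = t * (v * Lap s)" by simp
  then have "(s * t) * Lap v = t * Lap s * v" by (simp only: mult_ac)
  then show ?thesis by (simp add: s(2) v_def)
qed

text \<open>
  A priori \<open>Lap (Lap (q * v))\<close> contains fourth and third derivatives of
  \<open>v\<close>. They occur only within \<open>Lap v\<close> and its derivatives, apart from
  the second derivatives of \<open>v\<close> multiplied by those of \<open>q\<close>.
\<close>
lemma Lap_Lap_potential:
  assumes "Lap v = q * v"
  shows "Lap (Lap (q * v)) =
     (Lap (Lap q + q * q) + (Lap q + q * q) * q + cst 2 * (Dx q * Dx q + Dy q * Dy q)) * v
     + cst 2 * (Dx (Lap q + q * q) + Dx (Lap q) + q * Dx q) * Dx v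
     + cst 2 * (Dy (Lap q + q * q) + Dy (Lap q) + q * Dy q) * Dy v
     + cst 4 * (Dx (Dx q) * Dx (Dx v)) + cst 8 * (Dx (Dy q) * Dx (Dy v)) + cst 4 * (Dy (Dy q) * Dy (Dy v))"
proof -
  have Lx: "Lap (Dx v) = Dx q * v + q * Dx v" "Lap (Dy v) = Dy q * v + q * Dy v"
    by (simp_all add: Lap_Dx Lap_Dy assms Dx_mult Dy_mult)
  have two: "cst 2 = cst 1 + cst 1" "cst 4 = cst 1 + cst 1 + cst 1 + cst 1"
     "cst 8 = cst 1 + cst 1 + cst 1 + cst 1 + cst 1 + cst 1 + cst 1 + cst 1"
    by (rule jet_eqI; simp)+
  have c1: "cst 1 = 1" by (simp add: cst_def)
  have Lc: "Lap (cst 2 * V) = cst 2 * Lap V" for V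
    by (simp add: Lap_def Dx_mult Dy_mult algebra_simps)
  have "Lap (q * v) = (Lap q + q * q) * v + cst 2 * (Dx q * Dx v + Dy q * Dy v)"
    by (simp add: Lap_mult assms algebra_simps)
  then show ?thesis
    by (simp only: Lap_add Lc Lap_mult[of "Lap q + q * q"] Lap_mult[of "Dx q"] Lap_mult[of "Dy q"] Lx assms)
       (simp add: Lap_Dx Lap_Dy Dy_Dx two c1 algebra_simps)
qed

lemma sum_three: "(\<Sum>k\<in>{-1..1::int}. f k) = f (-1) + f 0 + f 1"
proof -
  have "{-1..1::int} = {-1, 0, 1}" by auto
  then show ?thesis by (simp add: add.assoc)
qed

text \<open>
  The weights are power series in \<open>h\<close>, so that variable coefficients can be
  absorbed into them.
\<close>
definition apply_stencil :: "(int \<Rightarrow> int \<Rightarrow> real fps) \<Rightarrow> real fps fps \<Rightarrow> real fps" where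
  "apply_stencil w V = (\<Sum>k\<in>{-1..1}. \<Sum>l\<in>{-1..1}. w k l * along (of_int k) (of_int l) V)"

text \<open>The nine-point Laplacian, scaled by \<open>6 h^2\<close>.\<close>
definition lap9 :: "int \<Rightarrow> int \<Rightarrow> real" where
  "lap9 k l = (if k = 0 \<and> l = 0 then - 20 else if k = 0 \<or> l = 0 then 4 else 1)"

definition second_diff :: "int \<Rightarrow> real" where
  "second_diff k = (if k = 0 then - 2 else 1)"

definition point_eval :: "int \<Rightarrow> real" where "point_eval k = (if k = 0 then 1 else 0)"

definition central_diff :: "int \<Rightarrow> real" where "central_diff k = of_int k / 2"

abbreviation cstencil :: "(int \<Rightarrow> int \<Rightarrow> real) \<Rightarrow> real fps fps \<Rightarrow> real fps" where
  "cstencil w \<equiv> apply_stencil (\<lambda>k l. fps_const (w k l))"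

lemma nth_cstencil: "fps_nth (cstencil w V) j =
   (\<Sum>i\<le>j. jc V i (j - i) * (\<Sum>k\<in>{-1..1}. \<Sum>l\<in>{-1..1}. w k l * of_int k ^ i * of_int l ^ (j - i)))"
  by (simp add: apply_stencil_def sum_three along_def sum_distrib_left sum.distrib[symmetric] algebra_simps)

lemmas stencil_expand = nth_cstencil sum_three lap9_def second_diff_def point_eval_def central_diff_def eval_nat_numeral

text \<open>
  The error terms involve \<open>Lap V\<close> only; so they can be controlled once \<open>Lap
  V\<close> is known. This distinguishes the nine-point Laplacian among the compact
  discretisations.
\<close>
lemma lap9_expansion:
  "fps_nth (cstencil lap9 V) 0 = 0"
  "fps_nth (cstencil lap9 V) 1 = 0"
  "fps_nth (cstencil lap9 V) 2 = 6 * jc (Lap V) 0 0"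
  "fps_nth (cstencil lap9 V) 3 = 0"
  "fps_nth (cstencil lap9 V) 4 = 1 / 2 * jc (Lap (Lap V)) 0 0"
  "fps_nth (cstencil lap9 V) 5 = 0"
  "fps_nth (cstencil lap9 V) 6 = 1 / 60 *
     (jc (Lap (Lap (Lap V))) 0 0 + 2 * jc (Dx (Dx (Dy (Dy (Lap V))))) 0 0)"
  "fps_nth (cstencil lap9 V) 7 = 0"
  by (simp_all add: stencil_expand Lap_def)

lemma less_8_cases: "j < 8 \<Longrightarrow> j = 0 \<or> j = 1 \<or> j = 2 \<or> j = 3 \<or> j = 4 \<or> j = 5 \<or> j = 6 \<or> j = (7::nat)"
  by auto

lemma second_diff_expansion:
  "j < 6 \<Longrightarrow> fps_nth (cstencil (\<lambda>k l. second_diff k * second_diff l) V) j = (if j = 4 then jc (Dx (Dx (Dy (Dy V)))) 0 0 else 0)"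
  using less_8_cases[of j] by (auto simp: stencil_expand)

text \<open>
  By parity the errors of order \<open>h^3\<close> vanish, so that in
  \<open>compact_stencil_potential\<close> a further factor \<open>h^4\<close> makes these
  approximations exact up to \<open>O(h^8)\<close>.
\<close>
lemma central_expansion:
  "j < 4 \<Longrightarrow> fps_nth (fps_X ^ 2 * cstencil (\<lambda>k l. point_eval k * point_eval l) V) j = (if j = 2 then jc V 0 0 else 0)"
  "j < 4 \<Longrightarrow> fps_nth (fps_X * cstencil (\<lambda>k l. central_diff k * point_eval l) V) j = (if j = 2 then jc (Dx V) 0 0 else 0)"
  "j < 4 \<Longrightarrow> fps_nth (fps_X * cstencil (\<lambda>k l. point_eval k * central_diff l) V) j = (if j = 2 then jc (Dy V) 0 0 else 0)"
  "j < 4 \<Longrightarrow> fps_nth (cstencil (\<lambda>k l. second_diff k * point_eval l) V) j = (if j = 2 then jc (Dx (Dx V)) 0 0 else 0)"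
  "j < 4 \<Longrightarrow> fps_nth (cstencil (\<lambda>k l. central_diff k * central_diff l) V) j = (if j = 2 then jc (Dx (Dy V)) 0 0 else 0)"
  "j < 4 \<Longrightarrow> fps_nth (cstencil (\<lambda>k l. point_eval k * second_diff l) V) j = (if j = 2 then jc (Dy (Dy V)) 0 0 else 0)"
  unfolding fps_X_power_mult_nth using less_8_cases[of j] by (auto simp: stencil_expand)

lemma along_0_0: "along 0 0 V = fps_const (jc V 0 0)"
  by (rule fps_ext) (auto simp: along_def power_0_left intro!: sum.neutral)

text \<open>
  Multiplying the weights by the values of \<open>q\<close> amounts to applying the stencil to
  \<open>q * V\<close>.
\<close>
lemma apply_stencil_along:
  "apply_stencil (\<lambda>k l. w k l * along (of_int k) (of_int l) q) V = apply_stencil w (q * V)"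
  by (simp add: apply_stencil_def along_mult mult.assoc)

lemma apply_stencil_linear:
  "apply_stencil (\<lambda>k l. w k l + w' k l) V = apply_stencil w V + apply_stencil w' V"
  "apply_stencil (\<lambda>k l. w k l - w' k l) V = apply_stencil w V - apply_stencil w' V"
  "apply_stencil (\<lambda>k l. c * w k l) V = c * apply_stencil w V"
  by (simp_all add: apply_stencil_def sum.distrib sum_subtractf sum_distrib_left algebra_simps)

text \<open>
  With \<open>W = q * v\<close>, the nine-point Laplacian \<open>S\<close> and the values of all
  derivatives at the centre, \<open>S v = 6 h^2 W + h^4/2 Lap W + h^6/60 (Lap^2 W + 2 W_xxyy) +
  O(h^8)\<close> and \<open>S W = 6 h^2 Lap W + h^4/2 Lap^2 W + O(h^6)\<close>. Hence \<open>S v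
  - 6 h^2 W - (h^2/12) S W\<close> equals \<open>h^6 (- Lap^2 W / 40 + W_xxyy / 30) +
  O(h^8)\<close>. Both terms are expressed by compact stencils: \<open>W_xxyy\<close> by a
  product of second differences of \<open>W\<close>, and \<open>Lap^2 W\<close> by central
  differences of \<open>v\<close>.
\<close>
theorem compact_stencil_potential:
  "\<exists>w. (\<forall>k l. fps_nth (w k l) 0 = lap9 k l) \<and>
     (\<forall>v. Lap v = q * v \<longrightarrow> (\<forall>j<8. fps_nth (apply_stencil w v) j = 0))"
proof -
  define p where "p = Lap q + q * q"
  define b_0 where "b_0 = jc (Lap p + p * q + cst 2 * (Dx q * Dx q + Dy q * Dy q)) 0 0"
  define b_x where "b_x = jc (cst 2 * (Dx p + Dx (Lap q) + q * Dx q)) 0 0"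
  define b_y where "b_y = jc (cst 2 * (Dy p + Dy (Lap q) + q * Dy q)) 0 0"
  define b_xx where "b_xx = 4 * jc (Dx (Dx q)) 0 0"
  define b_xy where "b_xy = 8 * jc (Dx (Dy q)) 0 0"
  define b_yy where "b_yy = 4 * jc (Dy (Dy q)) 0 0"
  \<comment> \<open>A stencil for \<open>h^2\<close> times the value of \<open>Lap (Lap (q * v))\<close> at the centre, up to \<open>O(h^4)\<close>.\<close>
  define r where "r = (\<lambda>k l.
      fps_const b_0 * (fps_X ^ 2 * fps_const (point_eval k * point_eval l))
    + fps_const b_x * (fps_X * fps_const (central_diff k * point_eval l)) + fps_const b_y * (fps_X * fps_const (point_eval k * central_diff l))
    + fps_const b_xx * fps_const (second_diff k * point_eval l) + fps_const b_xy * fps_const (central_diff k * central_diff l)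
    + fps_const b_yy * fps_const (point_eval k * second_diff l))"
  define w where "w = (\<lambda>k l. fps_const (lap9 k l)
      - fps_X ^ 2 * (fps_const 6 * (fps_const (point_eval k * point_eval l) * along (of_int k) (of_int l) q))
      - fps_X ^ 2 * (fps_const (1/12) * (fps_const (lap9 k l) * along (of_int k) (of_int l) q))
      - fps_X ^ 2 * (fps_const (1/30) * (fps_const (second_diff k * second_diff l) * along (of_int k) (of_int l) q))
      + fps_X ^ 4 * (fps_const (1/40) * r k l))"
  have w0: "fps_nth (w k l) 0 = lap9 k l" for k l
    by (simp add: w_def)
  have "fps_nth (apply_stencil w v) j = 0" if v: "Lap v = q * v" and j: "j < 8" for v j
  proof -
    have S: "apply_stencil w v = cstencil lap9 v
      - fps_X ^ 2 * (fps_const 6 * cstencil (\<lambda>k l. point_eval k * point_eval l) (q * v))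
      - fps_X ^ 2 * (fps_const (1/12) * cstencil lap9 (q * v))
      - fps_X ^ 2 * (fps_const (1/30) * cstencil (\<lambda>k l. second_diff k * second_diff l) (q * v))
      + fps_X ^ 4 * (fps_const (1/40) * apply_stencil r v)"
      unfolding w_def by (simp only: apply_stencil_linear apply_stencil_along)
    have R: "apply_stencil r v =
      fps_const b_0 * (fps_X ^ 2 * cstencil (\<lambda>k l. point_eval k * point_eval l) v)
    + fps_const b_x * (fps_X * cstencil (\<lambda>k l. central_diff k * point_eval l) v) + fps_const b_y * (fps_X * cstencil (\<lambda>k l. point_eval k * central_diff l) v)
    + fps_const b_xx * cstencil (\<lambda>k l. second_diff k * point_eval l) v + fps_const b_xy * cstencil (\<lambda>k l. central_diff k * central_diff l) v
    + fps_const b_yy * cstencil (\<lambda>k l. point_eval k * second_diff l) v"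
      unfolding r_def by (simp only: apply_stencil_linear)
    have LL: "jc (Lap (Lap (q * v))) 0 0 = b_0 * jc v 0 0 + b_x * jc (Dx v) 0 0 + b_y * jc (Dy v) 0 0
      + b_xx * jc (Dx (Dx v)) 0 0 + b_xy * jc (Dx (Dy v)) 0 0 + b_yy * jc (Dy (Dy v)) 0 0"
      unfolding Lap_Lap_potential[OF v] b_0_def b_x_def b_y_def b_xx_def b_xy_def b_yy_def p_def
      by (simp del: jc_Dx jc_Dy)
    have Rj: "fps_nth (apply_stencil r v) i = (if i = 2 then jc (Lap (Lap (q * v))) 0 0 else 0)" if "i < 4" for i
      unfolding LL R fps_add_nth fps_mult_left_const_nth central_expansion[OF that] by simp
    have C: "fps_nth (cstencil (\<lambda>k l. point_eval k * point_eval l) V) i = (if i = 0 then jc V 0 0 else 0)" for V i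
      by (simp add: apply_stencil_def sum_three point_eval_def along_0_0)
    note lap9 = lap9_expansion[unfolded One_nat_def]
    show ?thesis
      using less_8_cases[OF j] unfolding S fps_add_nth fps_sub_nth fps_X_power_mult_nth fps_mult_left_const_nth
      by (elim disjE; simp add: Rj C lap9 second_diff_expansion v add_divide_distrib)
  qed
  then show ?thesis using w0 by blast
qed

theorem compact_stencil_exists:
  assumes "jc A 0 0 > 0"
  obtains w where "fps_nth (w 0 0) 0 \<noteq> 0"
    "\<And>V j. Ell A V = 0 \<Longrightarrow> j < 8 \<Longrightarrow> fps_nth (apply_stencil w V) j = 0"
proof -
  obtain s t where s: "s * s = A" "s * t = 1" "jc s 0 0 \<noteq> 0"
    using jet_sqrt[OF assms] by blast
  obtain w where w: "\<And>k l. fps_nth (w k l) 0 = lap9 k l"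
      "\<And>v j. Lap v = (t * Lap s) * v \<Longrightarrow> j < 8 \<Longrightarrow> fps_nth (apply_stencil w v) j = 0"
    using compact_stencil_potential[of "t * Lap s"] by blast
  show ?thesis
  proof (rule that[of "\<lambda>k l. w k l * along (of_int k) (of_int l) s"])
    show "fps_nth (w 0 0 * along (of_int 0) (of_int 0) s) 0 \<noteq> 0"
      by (simp add: w(1) s(3) lap9_def)
    show "fps_nth (apply_stencil (\<lambda>k l. w k l * along (of_int k) (of_int l) s) V) j = 0"
      if "Ell A V = 0" "j < 8" for V j
      unfolding apply_stencil_along by (rule w(2)[OF Lap_sqrt_substitution[OF s(1,2) that(1)] that(2)])
  qed
qed

section \<open>Order of accuracy\<close>

lemma poly_bigo_1: "poly p \<in> O[at_right (0::real)](\<lambda>h. 1)"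
proof -
  have "(poly p \<longlongrightarrow> poly p 0) (at_right 0)"
    using isCont_tendsto_compose[OF poly_isCont[of _ p], of "\<lambda>h. h" 0 "at_right 0"] by simp
  then show ?thesis by (intro bigoI_tendsto[where c = "poly p 0"]) simp_all
qed

lemma poly_bigo_power:
  assumes "\<And>j. j < N \<Longrightarrow> coeff p j = 0"
  shows "poly p \<in> O[at_right (0::real)](\<lambda>h. h ^ N)"
proof -
  have "monom 1 N dvd p" using assms by (simp add: monom_1_dvd_iff')
  then obtain q where p: "p = monom 1 N * q" by blast
  have "(\<lambda>h. h ^ N * poly q h) \<in> O[at_right (0::real)](\<lambda>h. h ^ N * 1)"
    by (intro landau_o.big.mult landau_o.big_refl poly_bigo_1)
  moreover have "poly p = (\<lambda>h. h ^ N * poly q h)"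
    by (simp add: p poly_monom fun_eq_iff)
  ultimately show ?thesis by simp
qed

lemma power_bigo_power: "N \<le> M \<Longrightarrow> (\<lambda>h::real. h ^ M) \<in> O[at_right 0](\<lambda>h. h ^ N)"
proof -
  assume "N \<le> M"
  then have "poly (monom 1 M) \<in> O[at_right (0::real)](\<lambda>h. h ^ N)"
    by (intro poly_bigo_power) (simp add: coeff_monom)
  moreover have "poly (monom 1 M) = (\<lambda>h::real. h ^ M)"
    by (simp add: poly_monom fun_eq_iff)
  ultimately show ?thesis by simp
qed

lemma bigo_power_const_imp_zero:
  assumes "(\<lambda>h::real. c * h ^ d) \<in> O[at_right 0](\<lambda>h. h ^ Suc d)"
  shows "c = 0"
proof (rule ccontr)
  assume "c \<noteq> 0"
  obtain K where K: "K > 0" "\<forall>\<^sub>F h in at_right 0. norm (c * h ^ d) \<le> K * norm (h ^ Suc d)"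
    using assms by (rule landau_o.bigE)
  then obtain b where b: "b > 0" "\<And>h. 0 < h \<Longrightarrow> h < b \<Longrightarrow> \<bar>c * h ^ d\<bar> \<le> K * \<bar>h ^ Suc d\<bar>"
    by (auto simp: eventually_at_right_field)
  define h where "h = min (b / 2) (\<bar>c\<bar> / (2 * K))"
  have h: "0 < h" "h < b" "K * h < \<bar>c\<bar>"
    using b(1) K(1) \<open>c \<noteq> 0\<close> by (auto simp: h_def min_def field_simps)
  have "\<bar>c\<bar> * h ^ d \<le> K * h * h ^ d" using b(2)[OF h(1,2)] h(1) by (simp add: abs_mult mult_ac)
  then show False using h by simp
qed

lemma taylor_poly_linear:
  "taylor_poly K (V + W) x y = taylor_poly K V x y + taylor_poly K W x y"
  "taylor_poly K (V - W) x y = taylor_poly K V x y - taylor_poly K W x y"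
  "taylor_poly K (cst c * V) x y = c * taylor_poly K V x y"
  by (simp_all add: taylor_poly_def case_prod_unfold sum.distrib sum_subtractf sum_distrib_left algebra_simps)

lemma sum_stencil_swap:
  fixes c :: "int \<Rightarrow> int \<Rightarrow> real"
  shows "(\<Sum>p\<in>I. g p * (\<Sum>k\<in>{-1..1}. \<Sum>l\<in>{-1..1}. c k l * G p k l)) =
    (\<Sum>k\<in>{-1..1}. \<Sum>l\<in>{-1..1}. c k l * (\<Sum>p\<in>I. g p * G p k l))"
  unfolding sum_three by (simp add: distrib_left sum.distrib sum_distrib_left mult.left_commute)

lemma taylor_poly_sum: "taylor_poly K (\<Sum>s\<in>S. F s) x y = (\<Sum>s\<in>S. taylor_poly K (F s) x y)"
proof (induction S rule: infinite_finite_induct)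
  case (insert s S)
  then show ?case by (simp add: taylor_poly_linear)
qed (simp_all add: taylor_poly_def)

lemma taylor_poly_order_ge: "order_ge (K + 1) V \<Longrightarrow> taylor_poly K V x y = 0"
  unfolding taylor_poly_def by (intro sum.neutral) (auto simp: order_ge_def Lam_def)

context
  fixes a :: "real \<Rightarrow> real \<Rightarrow> real" and U :: "(real \<times> real) set" and x0 y0 :: real
  assumes U: "open U" "(x0, y0) \<in> U" and a: "smooth_on U a" and apos: "a x0 y0 \<noteq> 0"
begin

lemmas jet_context = U a apos refl

text \<open>
  \<open>jet_expansion\<close>, truncated after degree \<open>M + 1\<close> and evaluated at a
  point, is the identity on which the scheme rests.
\<close>
lemma taylor_poly_expansion:
  assumes u: "smooth_near u x0 y0" and M: "M \<ge> 1"
  shows "taylor_poly (M + 1) (jet x0 y0 u) x y =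
      (\<Sum>(m, n)\<in>LamV1 (M + 1). pd m n u x0 y0 * GV a x0 y0 M m n x y) +
      (\<Sum>(m, n)\<in>Lam (M - 1). pd m n (elliptic a u) x0 y0 * QV a x0 y0 M m n x y)"
proof -
  let ?A = "jet x0 y0 a" and ?V = "jet x0 y0 u"
  have L: "{(m, n). m + n + 2 \<le> M + 1} = Lam (M - 1)" using M by (auto simp: Lam_def)
  have "taylor_poly (M + 1) (?V - ((\<Sum>(m,n)\<in>LamV1 (M + 1). cst (jet_deriv ?V m n) * Gsol ?A m n)
     + (\<Sum>(m,n)\<in>Lam (M - 1). cst (jet_deriv (Ell ?A ?V) m n) * Qsol ?A m n))) x y = 0"
    by (rule taylor_poly_order_ge) (rule jet_expansion[OF A0_neq_0[OF jet_context], of "M + 1" ?V, unfolded L])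
  then have "taylor_poly (M + 1) ?V x y =
      (\<Sum>(m,n)\<in>LamV1 (M + 1). jet_deriv ?V m n * taylor_poly (M + 1) (Gsol ?A m n) x y)
    + (\<Sum>(m,n)\<in>Lam (M - 1). jet_deriv (Ell ?A ?V) m n * taylor_poly (M + 1) (Qsol ?A m n) x y)"
    by (simp add: taylor_poly_linear taylor_poly_sum case_prod_unfold)
  also have "(\<Sum>(m,n)\<in>LamV1 (M + 1). jet_deriv ?V m n * taylor_poly (M + 1) (Gsol ?A m n) x y)
    = (\<Sum>(m, n)\<in>LamV1 (M + 1). pd m n u x0 y0 * GV a x0 y0 M m n x y)"
    by (intro sum.cong refl) (auto simp: GV_eq[OF jet_context])
  also have "(\<Sum>(m,n)\<in>Lam (M - 1). jet_deriv (Ell ?A ?V) m n * taylor_poly (M + 1) (Qsol ?A m n) x y)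
    = (\<Sum>(m, n)\<in>Lam (M - 1). pd m n (elliptic a u) x0 y0 * QV a x0 y0 M m n x y)"
    unfolding jet_elliptic_near[OF jet_context u, symmetric] jet_deriv_jet
    using M by (intro sum.cong refl) (auto simp: QV_eq[OF jet_context] Lam_def)
  finally show ?thesis .
qed

lemma taylor_near:
  assumes u: "smooth_near u x0 y0"
  shows "(\<lambda>h. u (x0 + k * h) (y0 + l * h) - taylor_poly K (jet x0 y0 u) (k * h) (l * h))
     \<in> O[at_right 0](\<lambda>h. h ^ (K + 1))"
proof -
  obtain W where "open W" "(x0, y0) \<in> W" "smooth_on W u"
    using u by (auto simp: smooth_near_def)
  from taylor_along[OF this, of k l "Suc K"] show ?thesis
    unfolding along_taylor_poly lessThan_Suc_atMost by simp
qed

text \<open>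
  In the Taylor polynomial of \<open>u\<close> at the stencil points, the part with the
  functions \<open>QV\<close> cancels against the right-hand side of the scheme, the part with
  the functions \<open>GV\<close> is small by the assumption on the weights, and the Taylor
  remainder is \<open>O(h^(M + 2))\<close>.
\<close>
theorem scheme_accuracy:
  fixes C :: "int \<Rightarrow> int \<Rightarrow> real poly"
  assumes M: "M \<ge> 1" and nt: "nontrivial C"
    and C: "\<And>m n. (m, n) \<in> LamV1 (M + 1) \<Longrightarrow>
      (\<lambda>h. \<Sum>k\<in>{-1..1}. \<Sum>l\<in>{-1..1}. poly (C k l) h * GV a x0 y0 M m n (of_int k * h) (of_int l * h))
         \<in> O[at_right 0](\<lambda>h. h ^ (M + 2))"
  shows "scheme_has_order a x0 y0 C (Lam (M - 1))
              (\<lambda>m n h. \<Sum>k\<in>{-1..1}. \<Sum>l\<in>{-1..1}.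
                 poly (C k l) h * QV a x0 y0 M m n (of_int k * h) (of_int l * h)) M"
  unfolding scheme_has_order_def
proof (intro conjI allI impI nt finite_Lam)
  fix u assume u: "smooth_near u x0 y0"
  define R where "R = (\<lambda>k l h. u (x0 + of_int k * h) (y0 + of_int l * h)
      - taylor_poly (M + 1) (jet x0 y0 u) (of_int k * h) (of_int l * h))"
  define gd where "gd = (\<lambda>p. pd (fst p) (snd p) u x0 y0)"
  define qd where "qd = (\<lambda>p. pd (fst p) (snd p) (elliptic a u) x0 y0)"
  define Gv where "Gv = (\<lambda>p. GV a x0 y0 M (fst p) (snd p))"
  define Qv where "Qv = (\<lambda>p. QV a x0 y0 M (fst p) (snd p))"
  have u_eq: "u (x0 + of_int k * h) (y0 + of_int l * h) = R k l h
     + (\<Sum>p\<in>LamV1 (M + 1). gd p * Gv p (of_int k * h) (of_int l * h))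
     + (\<Sum>p\<in>Lam (M - 1). qd p * Qv p (of_int k * h) (of_int l * h))" for k l h
    unfolding R_def taylor_poly_expansion[OF u M] by (simp add: case_prod_unfold gd_def qd_def Gv_def Qv_def)
  have eq: "(\<Sum>k\<in>{-1..1}. \<Sum>l\<in>{-1..1}. poly (C k l) h * u (x0 + of_int k * h) (y0 + of_int l * h))
      - (\<Sum>(m, n)\<in>Lam (M - 1). pd m n (elliptic a u) x0 y0 *
          (\<Sum>k\<in>{-1..1}. \<Sum>l\<in>{-1..1}. poly (C k l) h * QV a x0 y0 M m n (of_int k * h) (of_int l * h)))
    = (\<Sum>k\<in>{-1..1}. \<Sum>l\<in>{-1..1}. poly (C k l) h * R k l h)
      + (\<Sum>p\<in>LamV1 (M + 1). gd p *
          (\<Sum>k\<in>{-1..1}. \<Sum>l\<in>{-1..1}. poly (C k l) h * Gv p (of_int k * h) (of_int l * h)))" for h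
    unfolding u_eq case_prod_unfold sum_stencil_swap
    by (simp add: sum.distrib distrib_left qd_def Qv_def)
  have "(\<lambda>h. (\<Sum>k\<in>{-1..1}. \<Sum>l\<in>{-1..1}. poly (C k l) h * R k l h)
      + (\<Sum>p\<in>LamV1 (M + 1). gd p *
          (\<Sum>k\<in>{-1..1}. \<Sum>l\<in>{-1..1}. poly (C k l) h * Gv p (of_int k * h) (of_int l * h))))
      \<in> O[at_right 0](\<lambda>h. h ^ (M + 2))"
  proof (intro sum_in_bigo big_sum_in_bigo)
    fix k l :: int
    have "R k l \<in> O[at_right 0](\<lambda>h. h ^ (M + 2))"
      using taylor_near[OF u, of "of_int k" "of_int l" "M + 1"] by (simp add: R_def)
    from landau_o.big.mult[OF poly_bigo_1 this, of "C k l"]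
    show "(\<lambda>h. poly (C k l) h * R k l h) \<in> O[at_right 0](\<lambda>h. h ^ (M + 2))" by simp
  next
    fix p assume "p \<in> LamV1 (M + 1)"
    then have "(\<lambda>h. \<Sum>k\<in>{-1..1}. \<Sum>l\<in>{-1..1}. poly (C k l) h * Gv p (of_int k * h) (of_int l * h))
       \<in> O[at_right 0](\<lambda>h. h ^ (M + 2))"
      unfolding Gv_def by (intro C) simp
    from landau_o.big.mult[OF bigo_const this, of "gd p"]
    show "(\<lambda>h. gd p * (\<Sum>k\<in>{-1..1}. \<Sum>l\<in>{-1..1}. poly (C k l) h * Gv p (of_int k * h) (of_int l * h)))
       \<in> O[at_right 0](\<lambda>h. h ^ (M + 2))"
      by simp
  qed
  then show "(\<lambda>h. (\<Sum>k\<in>{-1..1}. \<Sum>l\<in>{-1..1}. poly (C k l) h * u (x0 + of_int k * h) (y0 + of_int l * h))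
      - (\<Sum>(m, n)\<in>Lam (M - 1). pd m n (elliptic a u) x0 y0 *
          (\<Sum>k\<in>{-1..1}. \<Sum>l\<in>{-1..1}. poly (C k l) h * QV a x0 y0 M m n (of_int k * h) (of_int l * h))))
      \<in> O[at_right 0](\<lambda>h. h ^ (M + 2))"
    unfolding eq .
qed

text \<open>
  The weights of the formal stencil are truncated after \<open>h^7\<close>, which does not
  affect the coefficients below \<open>h^8\<close>.
\<close>
lemma sixth_order_exists:
  assumes pos: "a x0 y0 > 0"
  shows "\<exists>C S D. scheme_has_order a x0 y0 C S D 6"
proof -
  let ?A = "jet x0 y0 a"
  have "jc ?A 0 0 > 0" using pos by (simp add: A0[OF jet_context])
  then obtain w where w: "fps_nth (w 0 0) 0 \<noteq> 0"
    "\<And>V j. Ell ?A V = 0 \<Longrightarrow> j < 8 \<Longrightarrow> fps_nth (apply_stencil w V) j = 0"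
    using compact_stencil_exists by blast
  define tr :: "real fps \<Rightarrow> real poly" where "tr = (\<lambda>f. \<Sum>i\<le>7. monom (fps_nth f i) i)"
  have tr: "coeff (tr f) j = fps_nth f j" if "j < 8" for f j
    using that by (simp add: tr_def coeff_sum coeff_monom)
  have poly_tr: "poly (tr f) h = (\<Sum>i\<le>7. fps_nth f i * h ^ i)" for f h
    by (simp add: tr_def poly_sum poly_monom)
  define C where "C = (\<lambda>k l. tr (w k l))"
  have nt: "nontrivial C"
    unfolding nontrivial_def using w(1) by (intro bexI[of _ 0]) (auto simp: C_def poly_0_coeff_0 tr)
  have "(\<lambda>h. \<Sum>k\<in>{-1..1}. \<Sum>l\<in>{-1..1}. poly (C k l) h * GV a x0 y0 6 m n (of_int k * h) (of_int l * h))
         \<in> O[at_right 0](\<lambda>h. h ^ (6 + 2))" if mn: "(m, n) \<in> LamV1 (6 + 1)" for m n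
  proof -
    let ?G = "Gsol ?A m n"
    let ?P = "\<Sum>k\<in>{-1..1}. \<Sum>l\<in>{-1..1}. C k l * tr (along (of_int k) (of_int l) ?G)"
    have "coeff ?P j = 0" if "j < 8" for j
    proof -
      have "coeff ?P j = fps_nth (apply_stencil w ?G) j"
        unfolding apply_stencil_def coeff_sum fps_sum_nth C_def coeff_mult fps_mult_nth atMost_atLeast0
        using that by (intro sum.cong refl) (simp add: tr)
      also have "\<dots> = 0" by (rule w(2)[OF Gsol(1)[OF A0_neq_0[OF jet_context]] that])
      finally show ?thesis .
    qed
    then have "poly ?P \<in> O[at_right 0](\<lambda>h. h ^ 8)" by (rule poly_bigo_power)
    moreover have "poly ?P = (\<lambda>h. \<Sum>k\<in>{-1..1}. \<Sum>l\<in>{-1..1}.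
        poly (C k l) h * GV a x0 y0 6 m n (of_int k * h) (of_int l * h))"
      unfolding GV_eq[OF jet_context mn] along_taylor_poly by (simp add: fun_eq_iff poly_sum poly_tr)
    ultimately show ?thesis by simp
  qed
  from scheme_accuracy[OF _ nt this] show ?thesis by auto
qed

text \<open>
  The test function is a polynomial that agrees with \<open>Gsol m n\<close> to such a high
  order that all derivatives of \<open>f\<close> occurring in the right-hand side of the scheme
  vanish. Its values at the stencil points begin with \<open>h^(m + n)\<close> times the leading
  part of \<open>Gsol m n\<close>, and \<open>m + n < q + 2\<close>.
\<close>
lemma leading_part_annihilated:
  assumes sch: "scheme_has_order a x0 y0 C S D q" and mn: "m + n \<le> q + 1"
  shows "(\<Sum>k\<in>{-1..1}. \<Sum>l\<in>{-1..1}. poly (C k l) 0 *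
     fps_nth (along (of_int k) (of_int l) (Gsol (jet x0 y0 a) m n)) (m + n)) = 0"
proof -
  let ?G = "Gsol (jet x0 y0 a) m n" and ?d = "m + n"
  \<comment> \<open>A bound for all orders of differentiation in \<open>S\<close> that is also at least \<open>m + n\<close>.\<close>
  define K where "K = (\<Sum>(i, j)\<in>S. i + j) + ?d"
  have S: "finite S" using sch by (simp add: scheme_has_order_def)
  have SK: "i + j \<le> K" if "(i, j) \<in> S" for i j
    using member_le_sum[OF that, of "\<lambda>(i, j). i + j"] S by (simp add: K_def)
  obtain u where u: "smooth_near u x0 y0"
    "\<And>i j. i + j \<le> K + 2 \<Longrightarrow> pd i j u x0 y0 = jet_deriv ?G i j"
    "\<And>i j. i + j \<le> K \<Longrightarrow> pd i j (elliptic a u) x0 y0 = jet_deriv (Ell (jet x0 y0 a) ?G) i j"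
    using realise[OF jet_context, of K ?G] by blast
  have jets: "jc (jet x0 y0 u) i j = jc ?G i j" if "i + j \<le> ?d" for i j
  proof -
    have "jet_deriv (jet x0 y0 u) i j = jet_deriv ?G i j" using u(2)[of i j] that by (simp add: K_def)
    then show ?thesis by (simp add: jet_deriv_def)
  qed
  have zero: "(\<Sum>(i, j)\<in>S. pd i j (elliptic a u) x0 y0 * D i j h) = 0" for h
    by (intro sum.neutral) (auto simp: u(3)[OF SK] Gsol[OF A0_neq_0[OF jet_context]])
  have "(\<lambda>h. \<Sum>k\<in>{-1..1}. \<Sum>l\<in>{-1..1}. poly (C k l) h * u (x0 + of_int k * h) (y0 + of_int l * h))
      \<in> O[at_right 0](\<lambda>h. h ^ (q + 2))"
    using sch[unfolded scheme_has_order_def, THEN conjunct2, THEN conjunct2, rule_format, OF u(1)]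
    unfolding zero diff_0_right .
  from landau_o.big_trans[OF this power_bigo_power[of "?d + 1"]] mn
  have 1: "(\<lambda>h. \<Sum>k\<in>{-1..1}. \<Sum>l\<in>{-1..1}. poly (C k l) h * u (x0 + of_int k * h) (y0 + of_int l * h))
      \<in> O[at_right 0](\<lambda>h. h ^ (?d + 1))" by simp
  define H where "H = (\<lambda>k l :: int. fps_nth (along (of_int k) (of_int l) ?G) ?d)"
  have taylor_poly_u: "taylor_poly ?d (jet x0 y0 u) (of_int k * h) (of_int l * h) = H k l * h ^ ?d" for k l :: int and h
  proof -
    have "(\<Sum>j\<le>?d. fps_nth (along (of_int k) (of_int l) (jet x0 y0 u)) j * h ^ j)
        = (\<Sum>j\<le>?d. if j = ?d then H k l * h ^ ?d else 0)"
    proof (intro sum.cong refl)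
      fix j assume j: "j \<in> {..?d}"
      have "fps_nth (along (of_int k) (of_int l) (jet x0 y0 u)) j = fps_nth (along (of_int k) (of_int l) ?G) j"
        unfolding along_def fps_nth_Abs_fps using j by (intro sum.cong refl) (simp add: jets)
      moreover have "fps_nth (along (of_int k) (of_int l) ?G) j = 0" if "j < ?d"
        unfolding along_def fps_nth_Abs_fps
        using order_geD[OF order_ge_Gsol[OF A0_neq_0[OF jet_context], of m n]] that
        by (intro sum.neutral) simp
      ultimately show "fps_nth (along (of_int k) (of_int l) (jet x0 y0 u)) j * h ^ j
          = (if j = ?d then H k l * h ^ ?d else 0)"
        using j by (auto simp: H_def)
    qed
    then show ?thesis unfolding along_taylor_poly by simp
  qed
  have 2: "(\<lambda>h. poly (C k l) h * u (x0 + of_int k * h) (y0 + of_int l * h) - poly (C k l) 0 * H k l * h ^ ?d)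
      \<in> O[at_right 0](\<lambda>h. h ^ (?d + 1))" for k l :: int
  proof -
    have "(\<lambda>h. poly (C k l) h * (u (x0 + of_int k * h) (y0 + of_int l * h) - H k l * h ^ ?d))
        \<in> O[at_right 0](\<lambda>h. 1 * h ^ (?d + 1))"
      using taylor_near[OF u(1), of "of_int k" "of_int l" ?d] unfolding taylor_poly_u
      by (intro landau_o.big.mult poly_bigo_1)
    moreover have "(\<lambda>h. poly (C k l - [:poly (C k l) 0:]) h * (H k l * h ^ ?d)) \<in> O[at_right 0](\<lambda>h. h ^ 1 * h ^ ?d)"
      by (intro landau_o.big.mult poly_bigo_power) (auto simp: poly_0_coeff_0)
    ultimately have "(\<lambda>h. poly (C k l) h * (u (x0 + of_int k * h) (y0 + of_int l * h) - H k l * h ^ ?d)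
        + poly (C k l - [:poly (C k l) 0:]) h * (H k l * h ^ ?d)) \<in> O[at_right 0](\<lambda>h. h ^ (?d + 1))"
      by (intro sum_in_bigo) simp_all
    then show ?thesis by (simp add: algebra_simps)
  qed
  have "(\<lambda>h. \<Sum>k\<in>{-1..1}. \<Sum>l\<in>{-1..1}. poly (C k l) h * u (x0 + of_int k * h) (y0 + of_int l * h)
      - poly (C k l) 0 * H k l * h ^ ?d) \<in> O[at_right 0](\<lambda>h. h ^ (?d + 1))"
    by (intro big_sum_in_bigo 2)
  from sum_in_bigo(2)[OF 1 this]
  have "(\<lambda>h. (\<Sum>k\<in>{-1..1}. \<Sum>l\<in>{-1..1}. poly (C k l) 0 * H k l) * h ^ ?d) \<in> O[at_right 0](\<lambda>h. h ^ Suc ?d)"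
    by (simp add: sum_subtractf sum_distrib_right)
  from bigo_power_const_imp_zero[OF this] show ?thesis by (simp add: H_def)
qed

text \<open>
  The nine harmonic polynomials with leading Cauchy data \<open>1\<close>, \<open>y\<close>,
  \<open>x\<close>, \<open>y^2\<close>, \<open>x y\<close>, \<open>y^3\<close>, \<open>x
  y^2\<close>, \<open>y^4\<close> and \<open>y^8\<close> are linearly independent on the
  stencil; only the last one needs order seven.
\<close>
lemma order_at_most_six:
  assumes sch: "scheme_has_order a x0 y0 C S D q"
  shows "q \<le> 6"
proof (rule ccontr)
  assume "\<not> q \<le> 6"
  define c where "c = (\<lambda>k l. poly (C k l) 0)"
  note A0 = A0_neq_0[OF jet_context]
  have H: "(\<Sum>k\<in>{-1..1}. \<Sum>l\<in>{-1..1}. c k l * (\<Sum>i\<le>m + n.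
      (if m \<le> i \<and> even (i - m) then (-1) ^ ((i - m) div 2) else 0) / (fact i * fact (m + n - i))
        * of_int k ^ i * of_int l ^ (m + n - i))) = 0" if "m \<le> 1" "m + n \<le> 8" for m n
  proof -
    have "fps_nth (along k l (Gsol (jet x0 y0 a) m n)) (m + n) = (\<Sum>i\<le>m + n.
      (if m \<le> i \<and> even (i - m) then (-1) ^ ((i - m) div 2) else 0) / (fact i * fact (m + n - i))
        * k ^ i * l ^ (m + n - i))" for k l
      unfolding along_def fps_nth_Abs_fps
    proof (intro sum.cong refl)
      fix i assume "i \<in> {..m + n}"
      then have "jet_deriv (Gsol (jet x0 y0 a) m n) i (m + n - i)
          = (if m \<le> i \<and> even (i - m) then (-1) ^ ((i - m) div 2) else 0)"
        by (intro Gsol_leading[OF A0 that(1)]) simp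
      then have "jc (Gsol (jet x0 y0 a) m n) i (m + n - i)
          = (if m \<le> i \<and> even (i - m) then (-1) ^ ((i - m) div 2) else 0) / (fact i * fact (m + n - i))"
        unfolding jet_deriv_def by (simp add: eq_divide_eq mult_ac)
      then show "jc (Gsol (jet x0 y0 a) m n) i (m + n - i) * k ^ i * l ^ (m + n - i)
        = (if m \<le> i \<and> even (i - m) then (-1) ^ ((i - m) div 2) else 0) / (fact i * fact (m + n - i))
        * k ^ i * l ^ (m + n - i)" by simp
    qed
    then show ?thesis
      using leading_part_annihilated[OF sch, of m n] that \<open>\<not> q \<le> 6\<close> by (simp add: c_def)
  qed
  note expand = sum_three atMost_nat_numeral fact_numeral
  have 1: "c (-1) (-1) + c (-1) 0 + c (-1) 1 + c 0 (-1) + c 0 0 + c 0 1 + c 1 (-1) + c 1 0 + c 1 1 = 0"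
    using H[of 0 0] by (simp add: expand)
  have 2: "- c (-1) (-1) + c (-1) 1 - c 0 (-1) + c 0 1 - c 1 (-1) + c 1 1 = 0"
    using H[of 0 1] by (simp add: expand)
  have 3: "- c (-1) (-1) - c (-1) 0 - c (-1) 1 + c 1 (-1) + c 1 0 + c 1 1 = 0"
    using H[of 1 0] by (simp add: expand)
  have 4: "- c (-1) 0 + c 0 (-1) + c 0 1 - c 1 0 = 0"
    using H[of 0 2] by (simp add: expand)
  have 5: "c (-1) (-1) - c (-1) 1 - c 1 (-1) + c 1 1 = 0"
    using H[of 1 1] by (simp add: expand)
  have 6: "2 * c (-1) (-1) - 2 * c (-1) 1 - c 0 (-1) + c 0 1 + 2 * c 1 (-1) - 2 * c 1 1 = 0"
    using H[of 0 3] by (simp add: expand field_simps)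
  have 7: "- 2 * c (-1) (-1) + c (-1) 0 - 2 * c (-1) 1 + 2 * c 1 (-1) - c 1 0 + 2 * c 1 1 = 0"
    using H[of 1 2] by (simp add: expand field_simps)
  have 8: "- 4 * c (-1) (-1) + c (-1) 0 - 4 * c (-1) 1 + c 0 (-1) + c 0 1 - 4 * c 1 (-1) + c 1 0 - 4 * c 1 1 = 0"
    using H[of 0 4] by (simp add: expand field_simps)
  have 9: "16 * c (-1) (-1) + c (-1) 0 + 16 * c (-1) 1 + c 0 (-1) + c 0 1 + 16 * c 1 (-1) + c 1 0 + 16 * c 1 1 = 0"
    using H[of 0 8] by (simp add: expand field_simps)
  note eqs = 1 2 3 4 5 6 7 8 9
  have corners: "c (-1) (-1) = 0" "c (-1) 1 = 0" "c 1 (-1) = 0" "c 1 1 = 0"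
    using eqs by linarith+
  have edges: "c (-1) 0 = 0" "c 0 (-1) = 0" "c 0 1 = 0" "c 1 0 = 0"
    using eqs by linarith+
  have "c 0 0 = 0"
    using 1 corners edges by simp
  have "c k l = 0" if "k \<in> {-1..1}" "l \<in> {-1..1}" for k l
  proof -
    have "k \<in> {-1, 0, 1}" "l \<in> {-1, 0, 1}" using that by auto
    then show ?thesis using corners edges \<open>c 0 0 = 0\<close> by auto
  qed
  then show False
    using sch by (auto simp: scheme_has_order_def nontrivial_def c_def)
qed

end

theorem theorem2p1:
  fixes a :: "real \<Rightarrow> real \<Rightarrow> real" and x0 y0 :: real and U :: "(real \<times> real) set"
  assumes "open U" and "(x0, y0) \<in> U"
    and "smooth_on U a" and "\<forall>(x, y)\<in>U. a x y > 0"
  shows "(\<forall>(c :: int \<Rightarrow> int \<Rightarrow> nat \<Rightarrow> real) (C :: int \<Rightarrow> int \<Rightarrow> real poly).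
            (\<forall>k l. C k l = (\<Sum>i = 0..7. monom (c k l i) i)) \<longrightarrow>
            nontrivial C \<longrightarrow>
            (\<forall>(m, n)\<in>LamV1 7.
               (\<lambda>h. \<Sum>k\<in>{-1..1}. \<Sum>l\<in>{-1..1}.
                  poly (C k l) h * GV a x0 y0 6 m n (of_int k * h) (of_int l * h))
               \<in> O[at_right 0](\<lambda>h. h ^ 8)) \<longrightarrow>
            scheme_has_order a x0 y0 C (Lam 5)
              (\<lambda>m n h. \<Sum>k\<in>{-1..1}. \<Sum>l\<in>{-1..1}.
                 poly (C k l) h * QV a x0 y0 6 m n (of_int k * h) (of_int l * h)) 6)
         \<and> is_max_accuracy_order a x0 y0 6"
proof -
  have pos: "a x0 y0 > 0" using assms(2,4) by auto
  note ctx = assms(1-3) pos[THEN less_imp_neq, symmetric]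
  show ?thesis
  proof (intro conjI allI impI)
    fix c :: "int \<Rightarrow> int \<Rightarrow> nat \<Rightarrow> real" and C :: "int \<Rightarrow> int \<Rightarrow> real poly"
    assume nt: "nontrivial C" and C: "\<forall>(m, n)\<in>LamV1 7.
               (\<lambda>h. \<Sum>k\<in>{-1..1}. \<Sum>l\<in>{-1..1}.
                  poly (C k l) h * GV a x0 y0 6 m n (of_int k * h) (of_int l * h))
               \<in> O[at_right 0](\<lambda>h. h ^ 8)"
    have "scheme_has_order a x0 y0 C (Lam (6 - 1))
              (\<lambda>m n h. \<Sum>k\<in>{-1..1}. \<Sum>l\<in>{-1..1}.
                 poly (C k l) h * QV a x0 y0 6 m n (of_int k * h) (of_int l * h)) 6"
      by (rule scheme_accuracy[OF ctx _ nt]) (use C in auto)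
    then show "scheme_has_order a x0 y0 C (Lam 5)
              (\<lambda>m n h. \<Sum>k\<in>{-1..1}. \<Sum>l\<in>{-1..1}.
                 poly (C k l) h * QV a x0 y0 6 m n (of_int k * h) (of_int l * h)) 6" by simp
  next
    show "is_max_accuracy_order a x0 y0 6"
      unfolding is_max_accuracy_order_def
      using sixth_order_exists[OF ctx pos] order_at_most_six[OF ctx] by blast
  qed
qed

end
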